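(* There is a constant $\alpha > 0$ such that for all $n, m$ with $m \leq n/3$ there is a function $\mathsf{R}: \{0,1\}^n \to \{0,1\}^m$ with the following properties. Suppose $\mathcal{P}$ is an S-R randomized branching program on $\{0,1\}^n \times \{0,1\}^m$ that computes a function $f: \{0,1\}^n \to \{0,1\}$ with failure probability $\delta$, and suppose $T S m \leq \alpha n^2$, where $T = \mathrm{queries}(\mathcal{P})$ and $S = \lceil \log \mathrm{size}(\mathcal{P}) \rceil$. Then \[ \mathrm{density}\{x \in \{0,1\}^n : \mathcal{P}(x, \mathsf{R}(x)) \neq f(x)\} \leq 3\delta + m \cdot 2^{-\alpha n/m}. \] Furthermore, given $x$ and $m$, $\mathsf{R}(x)$ can be computed in space $O(\log n)$.
   Context: A randomized branching program on $\{0,1\}^n \times \{0,1\}^m$ is a directed acyclic graph in which each nonterminal vertex $v$ is labeled with indices $i(v) \in [n]$, $j(v) \in [m]$ and has four outgoing edges labeled by the four two-bit strings; on input $x$ and random string $y$ one follows from $v$ the edge labeled $x_{i(v)} y_{j(v)}$. It is S-R if for every edge $(v,v')$ between nonterminal vertices, $|i(v) - i(v')| \leq 1$. If a start vertex $v_0$ is designated and every terminal vertex is labeled with an output bit, $\mathcal{P}(x,y)$ is the output bit labeling the terminal vertex reached from $v_0$; $\mathcal{P}$ computes $f$ with failure probability $\delta$ if $\Pr_{y}[\mathcal{P}(x,y) = f(x)] \geq 1 - \delta$ for every $x$, $y$ uniform on $\{0,1\}^m$. $\mathrm{size}(\mathcal{P}) = |V(\mathcal{P})|$. The query complexity $\mathrm{queries}(\mathcal{P})$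 is the maximum over all paths $v_1, \dots, v_T$ of nonterminal vertices of $1 + \#\{t \in \{2,\dots,T\} : i(v_t) \neq i(v_{t-1})\}$. $\mathrm{density}(X) = |X|/2^n$. *)

theory Defs
  imports "HOL-Probability.Probability"
begin

definition bits :: "nat \<Rightarrow> bool list set" where
  "bits n = {x. length x = n}"

definition cube_density :: "nat \<Rightarrow> bool list set \<Rightarrow> real" where
  "cube_density n X = real (card X) / 2 ^ n"

section \<open>Randomized branching programs\<close>

text \<open>
  Vertices are natural numbers, which is no restriction since the graphs are finite. The
  terminal vertices are those in \<open>verts - nonterm\<close>. A nonterminal vertex \<open>v\<close> has the four
  outgoing edges \<open>(v, target v a b)\<close>, labeled \<open>ab\<close>; parallel edges are allowed. Positions of
  bit strings are counted from 0, so \<open>[n]\<close> is \<open>{..<n}\<close>. The values of \<open>xvar\<close>, \<open>yvar\<close> and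
  \<open>target\<close> outside \<open>nonterm\<close>, and of \<open>label\<close> on \<open>nonterm\<close>, are irrelevant.
\<close>

record rbp =
  verts :: "nat set"
  nonterm :: "nat set"
  xvar :: "nat \<Rightarrow> nat"
  yvar :: "nat \<Rightarrow> nat"
  target :: "nat \<Rightarrow> bool \<Rightarrow> bool \<Rightarrow> nat"
  start :: nat
  label :: "nat \<Rightarrow> bool"

definition edges :: "rbp \<Rightarrow> (nat \<times> nat) set" where
  "edges P = {(v, target P v a b) | v a b. v \<in> nonterm P}"

definition is_rbp :: "nat \<Rightarrow> nat \<Rightarrow> rbp \<Rightarrow> bool" where
  "is_rbp n m P \<longleftrightarrow>
     finite (verts P) \<and> nonterm P \<subseteq> verts P \<and> start P \<in> verts P \<and>
     (\<forall>v\<in>nonterm P. xvar P v < n \<and> yvar P v < m) \<and>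
     edges P \<subseteq> verts P \<times> verts P \<and> acyclic (edges P)"

definition is_SR :: "rbp \<Rightarrow> bool" where
  "is_SR P \<longleftrightarrow>
     (\<forall>(v, v') \<in> edges P. v \<in> nonterm P \<and> v' \<in> nonterm P \<longrightarrow>
        \<bar>int (xvar P v) - int (xvar P v')\<bar> \<le> 1)"

definition follow :: "rbp \<Rightarrow> bool list \<Rightarrow> bool list \<Rightarrow> (nat \<times> nat) set" where
  "follow P x y = {(v, target P v (x ! xvar P v) (y ! yvar P v)) | v. v \<in> nonterm P}"

text \<open>
  The relation \<open>follow P x y\<close> is a partial function and the graph is finite and acyclic, so
  exactly one terminal vertex is reached.
\<close>

definition rbp_output :: "rbp \<Rightarrow> bool list \<Rightarrow> bool list \<Rightarrow> bool" where
  "rbp_output P x y =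
     label P (THE v. (start P, v) \<in> (follow P x y)\<^sup>* \<and> v \<in> verts P - nonterm P)"

definition computes_with_failure ::
    "nat \<Rightarrow> nat \<Rightarrow> rbp \<Rightarrow> (bool list \<Rightarrow> bool) \<Rightarrow> real \<Rightarrow> bool" where
  "computes_with_failure n m P f \<delta> \<longleftrightarrow>
     (\<forall>x\<in>bits n.
        measure_pmf.prob (pmf_of_set (bits m)) {y. rbp_output P x y = f x} \<ge> 1 - \<delta>)"

definition rbp_size :: "rbp \<Rightarrow> nat" where
  "rbp_size P = card (verts P)"

definition nonterm_path :: "rbp \<Rightarrow> nat list \<Rightarrow> bool" where
  "nonterm_path P vs \<longleftrightarrow>
     vs \<noteq> [] \<and> set vs \<subseteq> nonterm P \<and> successively (\<lambda>v v'. (v, v') \<in> edges P) vs"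

text \<open>The inserted 0 is the value for programs without nonterminal vertices.\<close>

definition queries :: "rbp \<Rightarrow> nat" where
  "queries P = Max (insert 0
     {1 + card {t\<in>{1..<length vs}. xvar P (vs ! t) \<noteq> xvar P (vs ! (t - 1))} | vs.
        nonterm_path P vs})"

section \<open>Space-bounded Turing machines\<close>

text \<open>
  Deterministic Turing machines with a two-way read-only input tape, finitely many read-write
  work tapes (infinite to the right), and a write-only output tape. The states are
  \<open>{..<num_states}\<close> with start state 0; the work alphabet is \<open>{..<num_symbols}\<close> with blank
  symbol 0. A transition gets the state, the scanned input symbol and the scanned work symbols,
  and either halts (\<open>None\<close>) or yields the new state, the move of the input head, the symbol
  written and the move on each work tape, and possibly a bit to be appended to the output.
\<close>

datatype in_symbol = Left_End | Right_End | Separator | Bit bool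

datatype direction = Go_Left | Stay | Go_Right

record tm =
  num_states :: nat
  num_symbols :: nat
  num_tapes :: nat
  trans :: "nat \<Rightarrow> in_symbol \<Rightarrow> nat list \<Rightarrow>
    (nat \<times> direction \<times> (nat \<times> direction) list \<times> bool option) option"

definition is_tm :: "tm \<Rightarrow> bool" where
  "is_tm M \<longleftrightarrow>
     0 < num_states M \<and> 0 < num_symbols M \<and>
     (\<forall>q a ws q' d acts ob.
        q < num_states M \<and> length ws = num_tapes M \<and> set ws \<subseteq> {..<num_symbols M} \<and>
        trans M q a ws = Some (q', d, acts, ob) \<longrightarrow>
        q' < num_states M \<and> length acts = num_tapes M \<and>
        fst ` set acts \<subseteq> {..<num_symbols M})"

text \<open>
  A work tape is given by its head position and its contents. The input \<open>w\<close> occupies the cells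
  \<open>1, ..., length w\<close> of the input tape, between two end markers.
\<close>

record config =
  state :: nat
  in_pos :: nat
  work :: "(nat \<times> (nat \<Rightarrow> nat)) list"
  written :: "bool list"

definition init_config :: "tm \<Rightarrow> config" where
  "init_config M =
     \<lparr>state = 0, in_pos = 0, work = replicate (num_tapes M) (0, \<lambda>_. 0), written = []\<rparr>"

definition scanned :: "in_symbol list \<Rightarrow> nat \<Rightarrow> in_symbol" where
  "scanned w p =
     (if p = 0 then Left_End else if p \<le> length w then w ! (p - 1) else Right_End)"

fun move :: "direction \<Rightarrow> nat \<Rightarrow> nat" where
  "move Go_Left p = p - 1"
| "move Stay p = p"
| "move Go_Right p = p + 1"

definition tm_step :: "tm \<Rightarrow> in_symbol list \<Rightarrow> config \<Rightarrow> config option" where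
  "tm_step M w c =
     (case trans M (state c) (scanned w (in_pos c)) (map (\<lambda>(h, tape). tape h) (work c)) of
        None \<Rightarrow> None
      | Some (q, d, acts, ob) \<Rightarrow>
          Some \<lparr>state = q,
                in_pos = min (move d (in_pos c)) (length w + 1),
                work = map2 (\<lambda>(s, e) (h, tape). (move e h, tape(h := s))) acts (work c),
                written = written c @ (case ob of None \<Rightarrow> [] | Some b \<Rightarrow> [b])\<rparr>)"

definition tm_reachable :: "tm \<Rightarrow> in_symbol list \<Rightarrow> config \<Rightarrow> bool" where
  "tm_reachable M w c \<longleftrightarrow> (\<lambda>c c'. tm_step M w c = Some c')\<^sup>*\<^sup>* (init_config M) c"

text \<open>
  On input \<open>w\<close> the machine halts with output \<open>z\<close> and never visits more than the first \<open>s\<close> cells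
  of any work tape. The input and output tapes are not charged.
\<close>

definition computes_in_space ::
    "tm \<Rightarrow> in_symbol list \<Rightarrow> bool list \<Rightarrow> real \<Rightarrow> bool" where
  "computes_in_space M w z s \<longleftrightarrow>
     (\<exists>c. tm_reachable M w c \<and> tm_step M w c = None \<and> written c = z) \<and>
     (\<forall>c. tm_reachable M w c \<longrightarrow> (\<forall>(h, tape) \<in> set (work c). real (h + 1) \<le> s))"

text \<open>Binary representation, most significant bit first.\<close>

fun binary :: "nat \<Rightarrow> bool list" where
  "binary k = (if k = 0 then [] else binary (k div 2) @ [odd k])"

declare binary.simps [simp del]

definition encode_input :: "bool list \<Rightarrow> nat \<Rightarrow> in_symbol list" where
  "encode_input x m = map Bit x @ [Separator] @ map Bit (binary m)"

end

theory Submission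
  imports Defs
begin

text \<open>
  With \<open>k = n div (3 * m)\<close>, bit \<open>j\<close> of \<open>R(x)\<close> is the inner product modulo 2 of the \<open>j\<close>-th block
  of length \<open>k\<close> of \<open>x\<close> and the \<open>j\<close>-th block of the reversal of \<open>x\<close>. These blocks lie in the
  first and in the last third of \<open>x\<close>, so an S-R program has to spend at least \<open>n / 3\<close> queries to
  get from one to the other. When the rest of \<open>x\<close> is fixed, its output is therefore a sum of at
  most \<open>2 powr (3 * T * S / n)\<close> products of a function of the first block and a function of the
  second one, and the inner product is nearly uncorrelated with every such product (Parseval).

  Since the bits of \<open>R(x)\<close> other than bit \<open>j\<close> do not depend on the \<open>j\<close>-th blocks, the bits of a
  uniform \<open>y\<close> can be replaced by those of \<open>R(x)\<close> one at a time. As \<open>f\<close> itself need not be a short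
  sum of products, this is applied to the event that \<open>P(x, y)\<close> differs from \<open>P(x, z)\<close>, where \<open>z\<close>
  is a fixed string for which \<open>P(x, z) = f(x)\<close> for all but a fraction \<open>\<delta>\<close> of the inputs. The
  uniform \<open>y\<close> contributes \<open>2 * \<delta>\<close>, and \<open>z\<close> another \<open>\<delta>\<close>.

  For the space bound, a counter machine for \<open>R\<close> whose counters never exceed \<open>n\<close> is simulated
  with one binary counter on each work tape.
\<close>

section \<open>Bit strings and sums over the cube\<close>

lemma bits_0 [simp]: "bits 0 = {[]}"
  by (auto simp: bits_def)

lemma finite_bits [simp]: "finite (bits n)"
  using finite_lists_length_eq[of "UNIV :: bool set" n] by (simp add: bits_def)

lemma card_bits [simp]: "card (bits n) = 2 ^ n"
  using card_lists_length_eq[of "UNIV :: bool set" n] by (simp add: bits_def)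

lemma bits_nonempty [simp]: "bits n \<noteq> {}"
  using card_bits[of n] by fastforce

lemma length_bits: "x \<in> bits n \<Longrightarrow> length x = n"
  by (simp add: bits_def)

lemma sum_bits_append:
  "(\<Sum>x\<in>bits (p + q). F x) = (\<Sum>u\<in>bits p. \<Sum>v\<in>bits q. F (u @ v))"
proof -
  have "(\<Sum>u\<in>bits p. \<Sum>v\<in>bits q. F (u @ v)) = (\<Sum>(u, v)\<in>bits p \<times> bits q. F (u @ v))"
    by (rule sum.cartesian_product)
  also have "\<dots> = (\<Sum>x\<in>bits (p + q). F x)"
    by (rule sum.reindex_bij_witness[where j = "\<lambda>(u, v). u @ v" and i = "\<lambda>x. (take p x, drop p x)"])
      (auto simp: bits_def)
  finally show ?thesis ..
qed

lemma sum_bits_1: "(\<Sum>x\<in>bits (Suc 0). F x) = F [False] + F [True]"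
proof -
  have "bits (Suc 0) = {[False], [True]}"
    by (auto simp: bits_def length_Suc_conv)
  then show ?thesis by simp
qed

lemma sum_bits_Suc:
  "(\<Sum>x\<in>bits (Suc n). F x) = (\<Sum>v\<in>bits n. F (False # v)) + (\<Sum>v\<in>bits n. F (True # v))"
  using sum_bits_append[of F "Suc 0" n] by (simp add: sum_bits_1)

lemma sum_bits_rev: "(\<Sum>x\<in>bits n. F (rev x)) = (\<Sum>x\<in>bits n. F x)"
  by (rule sum.reindex_bij_witness[where j = rev and i = rev]) (auto simp: bits_def)

section \<open>Inner products\<close>

fun ip :: "bool list \<Rightarrow> bool list \<Rightarrow> bool" where
  "ip (a # as) (b # bs) = ((a \<and> b) \<noteq> ip as bs)"
| "ip _ _ = False"

definition bit_sign :: "bool \<Rightarrow> real" where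
  "bit_sign b = (if b then -1 else 1)"

lemma bit_sign_simps [simp]: "bit_sign True = -1" "bit_sign False = 1" "\<bar>bit_sign b\<bar> = 1"
  by (auto simp: bit_sign_def)

text \<open>Parseval for the Sylvester-Hadamard matrix with entries
  \<open>bit_sign (ip a b)\<close>. Splitting off the first bit of both arguments leaves two half
  sums, which the first bit of \<open>a\<close> combines into their sum or their difference; the
  parallelogram law removes the mixed terms.\<close>

lemma sum_sign_ip_square:
  "(\<Sum>a\<in>bits k. (\<Sum>b\<in>bits k. bit_sign (ip a b) * h b)\<^sup>2) = 2 ^ k * (\<Sum>b\<in>bits k. (h b)\<^sup>2)"
proof (induction k arbitrary: h)
  case 0
  then show ?case by simp
next
  case (Suc k)
  have parallelogram: "(p + q)\<^sup>2 + (p - q)\<^sup>2 = 2 * p\<^sup>2 + 2 * q\<^sup>2" for p q :: real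
    by (simp add: power2_eq_square algebra_simps)
  have signs: "bit_sign (ip (False # a) (c # b)) = bit_sign (ip a b)"
    "bit_sign (ip (True # a) (False # b)) = bit_sign (ip a b)"
    "bit_sign (\<not> ip a b) = - bit_sign (ip a b)" for a b c
    by (simp_all add: bit_sign_def)
  let ?u = "\<lambda>c a. \<Sum>b\<in>bits k. bit_sign (ip a b) * h (c # b)"
  have "(\<Sum>a\<in>bits (Suc k). (\<Sum>b\<in>bits (Suc k). bit_sign (ip a b) * h b)\<^sup>2) =
      (\<Sum>a\<in>bits k. (?u False a + ?u True a)\<^sup>2 + (?u False a - ?u True a)\<^sup>2)"
    by (simp add: sum_bits_Suc sum.distrib sum_negf signs flip: diff_conv_add_uminus)
  also have "\<dots> = 2 * (\<Sum>a\<in>bits k. (?u False a)\<^sup>2) + 2 * (\<Sum>a\<in>bits k. (?u True a)\<^sup>2)"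
    by (simp add: parallelogram sum.distrib sum_distrib_left)
  also have "\<dots> = 2 ^ Suc k * (\<Sum>b\<in>bits (Suc k). (h b)\<^sup>2)"
    by (simp add: Suc.IH sum_bits_Suc algebra_simps)
  finally show ?case .
qed

text \<open>Lindsey's lemma for bounded functions instead of rectangles: Cauchy-Schwarz over
  \<open>a\<close>, then Parseval. The trivial bound would be \<open>4 ^ k\<close>, so a factor of
  \<open>sqrt (2 ^ k)\<close> is gained.\<close>

lemma abs_sum_sign_ip_le:
  assumes g: "\<And>a. \<bar>g a\<bar> \<le> (1::real)" and h: "\<And>b. \<bar>h b\<bar> \<le> (1::real)"
  shows "\<bar>\<Sum>a\<in>bits k. \<Sum>b\<in>bits k. bit_sign (ip a b) * (g a * h b)\<bar> \<le> sqrt (8 ^ k)"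
proof -
  let ?u = "\<lambda>a. \<Sum>b\<in>bits k. bit_sign (ip a b) * h b"
  have sq: "(t::real)\<^sup>2 \<le> 1" if "\<bar>t\<bar> \<le> 1" for t
    using that by (simp add: abs_square_le_1)
  have "(\<Sum>a\<in>bits k. \<Sum>b\<in>bits k. bit_sign (ip a b) * (g a * h b))\<^sup>2 = (\<Sum>a\<in>bits k. g a * ?u a)\<^sup>2"
    by (simp add: sum_distrib_left mult_ac)
  also have "\<dots> \<le> (\<Sum>a\<in>bits k. (g a)\<^sup>2) * (\<Sum>a\<in>bits k. (?u a)\<^sup>2)"
    by (rule Cauchy_Schwarz_ineq_sum)
  also have "\<dots> \<le> 2 ^ k * (2 ^ k * 2 ^ k)"
  proof (rule mult_mono)
    show "(\<Sum>a\<in>bits k. (g a)\<^sup>2) \<le> 2 ^ k"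
      using sum_mono[of "bits k" "\<lambda>a. (g a)\<^sup>2" "\<lambda>_. 1"] sq[OF g] by simp
    have "(\<Sum>a\<in>bits k. (h a)\<^sup>2) \<le> 2 ^ k"
      using sum_mono[of "bits k" "\<lambda>a. (h a)\<^sup>2" "\<lambda>_. 1"] sq[OF h] by simp
    then show "(\<Sum>a\<in>bits k. (?u a)\<^sup>2) \<le> 2 ^ k * 2 ^ k"
      by (simp add: sum_sign_ip_square)
  qed (auto intro: sum_nonneg)
  also have "\<dots> = 8 ^ k"
    by (simp flip: power_mult_distrib)
  finally have "(\<Sum>a\<in>bits k. \<Sum>b\<in>bits k. bit_sign (ip a b) * (g a * h b))\<^sup>2 \<le> 8 ^ k" .
  then show ?thesis
    using real_sqrt_le_mono by fastforce
qed

section \<open>Sums of product functions\<close>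

text \<open>A variant of matrix rank in which the factors are bounded, so that each summand
  correlates with the inner product no more than a single product does.\<close>

inductive sep :: "nat \<Rightarrow> ('a \<Rightarrow> 'b \<Rightarrow> real) \<Rightarrow> bool" where
  sep_0: "sep 0 (\<lambda>_ _. 0)"
| sep_Suc: "\<lbrakk>sep N F; \<And>a. \<bar>g a\<bar> \<le> 1; \<And>b. \<bar>h b\<bar> \<le> 1\<rbrakk> \<Longrightarrow>
    sep (Suc N) (\<lambda>a b. F a b + g a * h b)"

lemma sep_1: "\<lbrakk>\<And>a. \<bar>g a\<bar> \<le> 1; \<And>b. \<bar>h b\<bar> \<le> 1\<rbrakk> \<Longrightarrow> sep 1 (\<lambda>a b. g a * h b)"
  using sep_Suc[OF sep_0, of g h] by simp

lemma sep_mono: "N \<le> M \<Longrightarrow> sep N F \<Longrightarrow> sep M F"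
proof (induction M rule: dec_induct)
  case (step M)
  then show ?case using sep_Suc[of M F "\<lambda>_. 0" "\<lambda>_. 0"] by simp
qed

lemma sep_add: "sep M G \<Longrightarrow> sep N F \<Longrightarrow> sep (N + M) (\<lambda>a b. F a b + G a b)"
proof (induction rule: sep.induct)
  case (sep_Suc M G g h)
  then show ?case
    using sep.sep_Suc[of "N + M" "\<lambda>a b. F a b + G a b" g h] by (simp add: add.assoc)
qed simp

lemma sep_scale:
  "sep N F \<Longrightarrow> (\<And>a. \<bar>g a\<bar> \<le> 1) \<Longrightarrow> (\<And>b. \<bar>h b\<bar> \<le> 1) \<Longrightarrow> sep N (\<lambda>a b. g a * h b * F a b)"
proof (induction rule: sep.induct)
  case sep_0
  then show ?case by (simp add: sep.sep_0)
next
  case (sep_Suc N F g' h')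
  have "\<bar>g a * g' a\<bar> \<le> 1" "\<bar>h b * h' b\<bar> \<le> 1" for a b
    using sep_Suc by (simp_all add: abs_mult mult_le_one)
  from sep.sep_Suc[OF sep_Suc.IH[OF sep_Suc.prems] this] show ?case
    by (simp add: algebra_simps)
qed

lemma sep_mult: "sep N F \<Longrightarrow> sep M G \<Longrightarrow> sep (N * M) (\<lambda>a b. F a b * G a b)"
proof (induction rule: sep.induct)
  case sep_0
  then show ?case by (simp add: sep.sep_0)
next
  case (sep_Suc N F g h)
  from sep_add[OF sep_scale[OF sep_Suc.prems, of g h, OF sep_Suc(2,3)] sep_Suc.IH[OF sep_Suc.prems]]
  show ?case by (simp add: algebra_simps)
qed

lemma sep_sum:
  "finite W \<Longrightarrow> (\<And>w. w \<in> W \<Longrightarrow> sep N (F w)) \<Longrightarrow> sep (card W * N) (\<lambda>a b. \<Sum>w\<in>W. F w a b)"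
proof (induction rule: finite_induct)
  case empty
  then show ?case by (simp add: sep.sep_0)
next
  case (insert w W)
  then show ?case
    using sep_add[of "card W * N" "\<lambda>a b. \<Sum>w\<in>W. F w a b" N "F w"] by (simp add: algebra_simps)
qed

lemma sep_swap: "sep N F \<Longrightarrow> sep N (\<lambda>b a. F a b)"
proof (induction rule: sep.induct)
  case sep_0
  then show ?case by (simp add: sep.sep_0)
next
  case (sep_Suc N F g h)
  then show ?case using sep.sep_Suc[of N "\<lambda>b a. F a b" h g] by (simp add: mult.commute)
qed

text \<open>The second block is read backwards from the end of \<open>x\<close>, hence the
  \<open>rev\<close>. As \<open>b\<close> runs through all strings, so does \<open>rev b\<close>,
  which turns \<open>h\<close> into \<open>h \<circ> rev\<close>; the bounds for the single products
  add up.\<close>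

lemma abs_sum_sign_ip_sep_le:
  "sep N F \<Longrightarrow> \<bar>\<Sum>a\<in>bits k. \<Sum>b\<in>bits k. bit_sign (ip a (rev b)) * F a b\<bar> \<le> real N * sqrt (8 ^ k)"
proof (induction rule: sep.induct)
  case (sep_Suc N F g h)
  have "(\<Sum>b\<in>bits k. bit_sign (ip a (rev b)) * (g a * h b)) =
      (\<Sum>b\<in>bits k. bit_sign (ip a b) * (g a * h (rev b)))" for a
    using sum_bits_rev[of "\<lambda>b. bit_sign (ip a b) * (g a * h (rev b))" k] by simp
  then have "\<bar>\<Sum>a\<in>bits k. \<Sum>b\<in>bits k. bit_sign (ip a (rev b)) * (g a * h b)\<bar> \<le> sqrt (8 ^ k)"
    using abs_sum_sign_ip_le[of g "h \<circ> rev" k] sep_Suc by simp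
  with sep_Suc.IH show ?case
    by (simp add: sum.distrib algebra_simps)
qed simp

section \<open>Runs of branching programs\<close>

text \<open>A run that is followed only while it stays in \<open>U\<close>; all vertices outside
  \<open>U\<close> are treated as terminal. This allows a run to be cut into pieces, and
  \<open>U = nonterm P\<close> gives the whole run.\<close>

definition walk :: "rbp \<Rightarrow> nat set \<Rightarrow> bool list \<Rightarrow> bool list \<Rightarrow> (nat \<times> nat) set" where
  "walk P U x y = {(v, target P v (x ! xvar P v) (y ! yvar P v)) | v. v \<in> U}"

definition stop :: "rbp \<Rightarrow> nat set \<Rightarrow> bool list \<Rightarrow> bool list \<Rightarrow> nat \<Rightarrow> nat" where
  "stop P U x y v = (THE w. (v, w) \<in> (walk P U x y)\<^sup>* \<and> w \<in> verts P - U)"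

definition changes :: "rbp \<Rightarrow> nat list \<Rightarrow> nat" where
  "changes P vs = card {t\<in>{1..<length vs}. xvar P (vs ! t) \<noteq> xvar P (vs ! (t - 1))}"

lemma changes_Cons_Cons:
  "changes P (v # w # vs) = (if xvar P v = xvar P w then 0 else 1) + changes P (w # vs)"
proof -
  let ?A = "\<lambda>us. {t\<in>{1..<length us}. xvar P (us ! t) \<noteq> xvar P (us ! (t - 1))}"
  have "?A (v # w # vs) = (if xvar P v = xvar P w then {} else {1}) \<union> Suc ` ?A (w # vs)"
  proof (intro set_eqI iffI)
    fix t assume t: "t \<in> ?A (v # w # vs)"
    show "t \<in> (if xvar P v = xvar P w then {} else {1}) \<union> Suc ` ?A (w # vs)"
    proof (cases "t = 1")
      case True
      with t show ?thesis by auto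
    next
      case False
      with t obtain u where "t = Suc (Suc u)"
        by (cases t; cases "t - 1") auto
      with t have "Suc u \<in> ?A (w # vs)" by auto
      with \<open>t = Suc (Suc u)\<close> show ?thesis by blast
    qed
  qed (auto split: if_splits simp: nth_Cons')
  moreover have "card ((if xvar P v = xvar P w then {} else {1}) \<union> Suc ` ?A (w # vs)) =
      (if xvar P v = xvar P w then 0 else 1) + card (?A (w # vs))"
    by (subst card_Un_disjoint) (auto simp: card_image)
  ultimately show ?thesis unfolding changes_def by simp
qed

locale branching_program =
  fixes n m P
  assumes rbp: "is_rbp n m P"
begin

lemma wf_edges: "wf ((edges P)\<inverse>)"
proof (rule finite_acyclic_wf_converse)
  show "finite (edges P)"
    using rbp finite_subset[of "edges P" "verts P \<times> verts P"] by (simp add: is_rbp_def)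
qed (use rbp in \<open>simp add: is_rbp_def\<close>)

lemma finite_verts: "finite (verts P)" and nonterm_verts: "nonterm P \<subseteq> verts P"
  and start_verts: "start P \<in> verts P"
  using rbp by (simp_all add: is_rbp_def)

lemma edge_target: "v \<in> nonterm P \<Longrightarrow> (v, target P v a b) \<in> edges P"
  by (auto simp: edges_def)

lemma target_verts: "v \<in> nonterm P \<Longrightarrow> target P v a b \<in> verts P"
  using edge_target rbp by (fastforce simp: is_rbp_def)

text \<open>A finite acyclic graph is well-founded against its edges, so facts on restricted runs
  are proved backwards from the vertices where they stop.\<close>

lemma vertex_induct [consumes 2, case_names stopped step]:
  assumes "v \<in> verts P" and U: "U \<subseteq> nonterm P"
    and stopped: "\<And>v. v \<in> verts P \<Longrightarrow> v \<notin> U \<Longrightarrow> Q v"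
    and step: "\<And>v. v \<in> U \<Longrightarrow> (\<And>a b. Q (target P v a b)) \<Longrightarrow> Q v"
  shows "Q v"
  using wf_edges \<open>v \<in> verts P\<close>
proof (induction v rule: wf_induct_rule)
  case (less v)
  show ?case
  proof (cases "v \<in> U")
    case True
    then have "Q (target P v a b)" for a b
      using less.IH[of "target P v a b"] edge_target target_verts U by blast
    with True show ?thesis by (rule step)
  qed (use less.prems in \<open>rule stopped\<close>)
qed

lemma stop_ex1:
  assumes "v \<in> verts P" "U \<subseteq> nonterm P"
  shows "\<exists>!w. (v, w) \<in> (walk P U x y)\<^sup>* \<and> w \<in> verts P - U"
  using assms
proof (induction rule: vertex_induct)
  case (stopped v)
  show ?case
  proof (rule ex1I[of _ v])
    fix w assume "(v, w) \<in> (walk P U x y)\<^sup>* \<and> w \<in> verts P - U"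
    then show "w = v" using stopped by (auto elim: converse_rtranclE simp: walk_def)
  qed (use stopped in auto)
next
  case (step v)
  let ?t = "target P v (x ! xvar P v) (y ! yvar P v)"
  have "(v, w) \<in> (walk P U x y)\<^sup>* \<and> w \<in> verts P - U \<longleftrightarrow>
      (?t, w) \<in> (walk P U x y)\<^sup>* \<and> w \<in> verts P - U" for w
  proof
    assume "(v, w) \<in> (walk P U x y)\<^sup>* \<and> w \<in> verts P - U"
    then show "(?t, w) \<in> (walk P U x y)\<^sup>* \<and> w \<in> verts P - U"
      using step(1) by (auto elim: converse_rtranclE simp: walk_def)
  next
    have "(v, ?t) \<in> walk P U x y" using step(1) by (auto simp: walk_def)
    then show "(?t, w) \<in> (walk P U x y)\<^sup>* \<and> w \<in> verts P - U \<Longrightarrow>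
        (v, w) \<in> (walk P U x y)\<^sup>* \<and> w \<in> verts P - U"
      by (auto intro: converse_rtrancl_into_rtrancl)
  qed
  with step(2)[of "x ! xvar P v" "y ! yvar P v"] show ?case by simp
qed

lemma stop_props:
  assumes "v \<in> verts P" "U \<subseteq> nonterm P"
  shows walk_stop: "(v, stop P U x y v) \<in> (walk P U x y)\<^sup>*"
    and stop_verts: "stop P U x y v \<in> verts P - U"
  using theI'[OF stop_ex1[OF assms, of x y]] unfolding stop_def by blast+

lemma stop_eqI:
  assumes "v \<in> verts P" "U \<subseteq> nonterm P" "(v, w) \<in> (walk P U x y)\<^sup>*" "w \<in> verts P - U"
  shows "stop P U x y v = w"
  unfolding stop_def by (rule the1_equality[OF stop_ex1[OF assms(1,2)]]) (use assms in blast)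

lemma stop_step:
  assumes "v \<in> U" "U \<subseteq> nonterm P"
  shows "stop P U x y v = stop P U x y (target P v (x ! xvar P v) (y ! yvar P v))"
proof (rule stop_eqI)
  let ?t = "target P v (x ! xvar P v) (y ! yvar P v)"
  have t: "?t \<in> verts P" using assms target_verts by blast
  have "(v, ?t) \<in> walk P U x y" using assms by (auto simp: walk_def)
  then show "(v, stop P U x y ?t) \<in> (walk P U x y)\<^sup>*"
    using walk_stop[OF t assms(2)] by (rule converse_rtrancl_into_rtrancl)
  show "stop P U x y ?t \<in> verts P - U" by (rule stop_verts[OF t assms(2)])
qed (use assms nonterm_verts in auto)

lemma stop_stopped: "v \<in> verts P \<Longrightarrow> v \<notin> U \<Longrightarrow> U \<subseteq> nonterm P \<Longrightarrow> stop P U x y v = v"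
  by (rule stop_eqI) auto

text \<open>Cutting a run where it first leaves \<open>U\<close> does not change where it ends,
  since both runs take the same steps inside \<open>U\<close>.\<close>

lemma stop_stop:
  assumes "v \<in> verts P" "U \<subseteq> nonterm P"
  shows "stop P (nonterm P) x y (stop P U x y v) = stop P (nonterm P) x y v"
  using assms
proof (induction rule: vertex_induct)
  case (step v)
  with assms(2) show ?case
    using stop_step[of v U x y] stop_step[of v "nonterm P" x y] by auto
qed (simp add: stop_stopped assms)

text \<open>Up to its exit from \<open>U\<close>, a run reads \<open>x\<close> only at the indices
  of vertices in \<open>U\<close>.\<close>

lemma stop_cong:
  assumes "v \<in> verts P" "U \<subseteq> nonterm P" "\<And>u. u \<in> U \<Longrightarrow> x ! xvar P u = x' ! xvar P u"
  shows "stop P U x y v = stop P U x' y v"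
  using assms(1,2)
proof (induction rule: vertex_induct)
  case (step v)
  with assms(2,3) show ?case
    using stop_step[of v U x y] stop_step[of v U x' y] by auto
qed (simp add: stop_stopped assms)

lemma edges_stop:
  assumes "v \<in> verts P" "U \<subseteq> nonterm P"
  shows "(v, stop P U x y v) \<in> (edges P)\<^sup>*"
proof -
  have "walk P U x y \<subseteq> edges P" using assms(2) by (auto simp: walk_def edges_def)
  then show ?thesis using walk_stop[OF assms] rtrancl_mono by blast
qed

lemma rbp_output_stop: "rbp_output P x y = label P (stop P (nonterm P) x y (start P))"
  by (simp add: rbp_output_def stop_def walk_def follow_def)

text \<open>Every run ends in a terminal vertex, so at least one exists. The spare unit later pays
  for the summand of those runs that end before they cross to the other player.\<close>

lemma card_nonterm: "Suc (card (nonterm P)) \<le> rbp_size P"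
proof -
  have "stop P (nonterm P) [] [] (start P) \<in> verts P - nonterm P"
    using stop_verts start_verts by blast
  then have "nonterm P \<subset> verts P" using nonterm_verts by blast
  then show ?thesis
    using psubset_card_mono[OF finite_verts] by (simp add: rbp_size_def Suc_leI)
qed

lemma nonterm_path_Cons:
  "(v, hd vs) \<in> edges P \<Longrightarrow> nonterm_path P vs \<Longrightarrow> nonterm_path P (v # vs)"
  by (cases vs) (auto simp: nonterm_path_def edges_def)

lemma nonterm_path_reaches:
  assumes "nonterm_path P (v # vs)"  and "w \<in> set vs"
  shows "(v, w) \<in> (edges P)\<^sup>+"
  using assms
proof (induction vs arbitrary: v)
  case (Cons u vs)
  then have "(v, u) \<in> edges P" "nonterm_path P (u # vs)"
    by (auto simp: nonterm_path_def)
  with Cons show ?case by (cases "w = u") (auto intro: trancl_into_trancl2)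
qed simp

lemma nonterm_path_distinct: "nonterm_path P vs \<Longrightarrow> distinct vs"
proof (induction vs)
  case (Cons v vs)
  have "v \<notin> set vs"
    using nonterm_path_reaches[OF Cons.prems, of v] rbp by (auto simp: is_rbp_def acyclic_def)
  moreover have "distinct vs"
    using Cons by (cases vs) (auto simp: nonterm_path_def)
  ultimately show ?case by simp
qed simp

text \<open>A path in an acyclic graph repeats no vertex, so the number of changes is at most the
  number of vertices. Hence the maximum in \<open>queries\<close> is over a finite set and bounds
  all its elements.\<close>

lemma changes_less_queries:
  assumes "nonterm_path P vs"
  shows "changes P vs < queries P"
proof -
  let ?S = "{1 + card {t\<in>{1..<length vs}. xvar P (vs ! t) \<noteq> xvar P (vs ! (t - 1))} | vs.
        nonterm_path P vs}"
  have "?S \<subseteq> {..Suc (card (verts P))}"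
  proof
    fix c assume "c \<in> ?S"
    then obtain us where us: "nonterm_path P us" and c: "c = 1 + changes P us"
      by (auto simp: changes_def)
    have "changes P us \<le> card {1..<length us}"
      unfolding changes_def by (rule card_mono) auto
    also have "\<dots> \<le> card (set us)"
      using nonterm_path_distinct[OF us] by (simp add: distinct_card)
    also have "\<dots> \<le> card (verts P)"
      using us nonterm_verts finite_verts by (intro card_mono) (auto simp: nonterm_path_def)
    finally show "c \<in> {..Suc (card (verts P))}" using c by simp
  qed
  then have fin: "finite ?S" using finite_subset by blast
  have "1 + changes P vs \<in> ?S" using assms by (auto simp: changes_def)
  then have "1 + changes P vs \<le> queries P"
    unfolding queries_def using fin by (intro Max_ge) auto
  then show ?thesis by simp
qed

text \<open>The query budget left to a run that has arrived at \<open>v\<close>.\<close>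

definition limited :: "nat \<Rightarrow> nat \<Rightarrow> bool" where
  "limited Q v \<longleftrightarrow> (\<forall>vs. nonterm_path P vs \<and> hd vs = v \<longrightarrow> changes P vs \<le> Q)"

text \<open>An S-R edge shifts the index by at most one, so getting from \<open>v\<close> to
  \<open>w\<close> takes at least as many changes as the distance of their indices. Prepending such
  a path to any path from \<open>w\<close> shows that these changes are lost from the
  budget.\<close>

lemma limited_reachable:
  assumes SR: "is_SR P" and vw: "(v, w) \<in> (edges P)\<^sup>*" and w: "w \<in> nonterm P" and Q: "limited Q v"
  shows "nat \<bar>int (xvar P v) - int (xvar P w)\<bar> \<le> Q \<and>
    limited (Q - nat \<bar>int (xvar P v) - int (xvar P w)\<bar>) w"
proof -
  have ex: "\<exists>us. nonterm_path P us \<and> hd us = v \<and>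
      changes P vs + nat \<bar>int (xvar P v) - int (xvar P w)\<bar> \<le> changes P us"
    if vs: "nonterm_path P vs" "hd vs = w" for vs
    using vw
  proof (induction rule: converse_rtrancl_induct)
    case base
    then show ?case using vs by auto
  next
    case (step v v')
    then obtain us where us: "nonterm_path P us" "hd us = v'"
      "changes P vs + nat \<bar>int (xvar P v') - int (xvar P w)\<bar> \<le> changes P us" by blast
    then obtain us' where us': "us = v' # us'" by (cases us) (auto simp: nonterm_path_def)
    have "\<bar>int (xvar P v) - int (xvar P v')\<bar> \<le> 1"
      using SR step(1) us us' by (auto simp: is_SR_def nonterm_path_def edges_def)
    then have "changes P vs + nat \<bar>int (xvar P v) - int (xvar P w)\<bar> \<le> changes P (v # us)"
      using us(3) by (auto simp: us' changes_Cons_Cons)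
    moreover have "nonterm_path P (v # us)"
      using nonterm_path_Cons us step(1) by simp
    ultimately show ?case by fastforce
  qed
  have "nonterm_path P [w]" using w by (simp add: nonterm_path_def)
  from ex[OF this] have "nat \<bar>int (xvar P v) - int (xvar P w)\<bar> \<le> Q"
    using Q by (fastforce simp: limited_def)
  moreover have "limited (Q - nat \<bar>int (xvar P v) - int (xvar P w)\<bar>) w"
    unfolding limited_def
  proof (intro allI impI)
    fix vs assume "nonterm_path P vs \<and> hd vs = w"
    then obtain us where us: "nonterm_path P us" "hd us = v"
      "changes P vs + nat \<bar>int (xvar P v) - int (xvar P w)\<bar> \<le> changes P us"
      using ex by blast
    then have "changes P us \<le> Q" using Q by (auto simp: limited_def)
    with us show "changes P vs \<le> Q - nat \<bar>int (xvar P v) - int (xvar P w)\<bar>" by linarith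
  qed
  ultimately show ?thesis ..
qed

text \<open>
  Two players hold \<open>a\<close> and \<open>b\<close> and know all bits of \<open>X a b\<close> outside of \<open>J\<close> and \<open>I\<close>, respectively.
  A run is cut whenever it leaves the territory of one player, which costs \<open>g\<close> queries.
\<close>

lemma sep_stop_side:
  fixes X :: "bool list \<Rightarrow> bool list \<Rightarrow> bool list"
  assumes SR: "is_SR P" and g: "g > 0"
    and "\<And>a b b' i. i \<notin> J \<Longrightarrow> X a b ! i = X a b' ! i"
    and "\<And>a a' b i. i \<notin> I \<Longrightarrow> X a b ! i = X a' b ! i"
    and "\<And>i j. i \<in> I \<Longrightarrow> j \<in> J \<Longrightarrow> int g \<le> \<bar>int i - int j\<bar>"
    and "v \<in> nonterm P" "xvar P v \<in> I" "limited Q v" "Q < (r + 1) * g"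
  shows "sep (rbp_size P ^ r) (\<lambda>a b. bit_sign (label P (stop P (nonterm P) (X a b) y v)))"
  using assms(3-)
proof (induction r arbitrary: X I J v Q rule: less_induct)
  case (less r X I J v Q)
  let ?N = "nonterm P"
  \<comment> \<open>\<open>U\<close> is the territory that the holder of \<open>a\<close> can
    process alone; \<open>W\<close> collects the vertices at which the holder of \<open>b\<close>
    may have to take over.\<close>
  define U where "U = {u \<in> ?N. xvar P u \<notin> J}"
  define W where "W = {w \<in> ?N. xvar P w \<in> J \<and> (v, w) \<in> (edges P)\<^sup>*}"
  define out where "out w a b = bit_sign (label P (stop P ?N (X a b) y w))" for w a b
  \<comment> \<open>Inside \<open>U\<close> the run does not depend on \<open>b\<close>, so the
    dummy value \<open>[]\<close> serves for it.\<close>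
  define hit where "hit a = stop P U (X a []) y v" for a
  have U: "U \<subseteq> ?N" and v: "v \<in> verts P"
    using nonterm_verts less.prems by (auto simp: U_def)
  have fin: "finite W"
    using finite_verts nonterm_verts by (auto simp: W_def intro: finite_subset)
  have hit: "stop P U (X a b) y v = hit a" for a b
    unfolding hit_def by (rule stop_cong[OF v U]) (use less.prems(1) in \<open>auto simp: U_def\<close>)
  have hit_verts: "hit a \<in> verts P - U" for a
    unfolding hit_def by (rule stop_verts[OF v U])
  have out_hit: "out v a b = out (hit a) a b" for a b
    using stop_stop[OF v U, of "X a b" y] by (simp add: out_def hit)
  have hit_W: "hit a \<in> W" if "hit a \<in> ?N" for a
    using that hit_verts[of a] edges_stop[OF v U, of "X a []" y] by (auto simp: W_def U_def hit_def)
  \<comment> \<open>Going from \<open>I\<close> to \<open>J\<close> uses up at least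
    \<open>g\<close> changes, so the budget pays for at most \<open>r\<close> crossings; for
    \<open>r = 0\<close> there is no crossing at all.\<close>
  have crossing: "0 < r \<and> limited (Q - g) w \<and> Q - g < r * g" if "w \<in> W" for w
  proof -
    let ?d = "nat \<bar>int (xvar P v) - int (xvar P w)\<bar>"
    have d: "?d \<le> Q" "limited (Q - ?d) w"
      using limited_reachable[OF SR, of v w Q] that less.prems by (auto simp: W_def)
    have gd: "g \<le> ?d"
      using less.prems(3)[of "xvar P v" "xvar P w"] less.prems(5) that by (auto simp: W_def)
    with d less.prems(7) have "0 < r" by (cases r) auto
    moreover have "limited (Q - g) w"
      using d(2) gd by (fastforce simp: limited_def)
    moreover have "Q - g < r * g"
      using less.prems(7) \<open>0 < r\<close> g by (cases r) (auto simp: algebra_simps)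
    ultimately show ?thesis by blast
  qed
  \<comment> \<open>From \<open>w\<close> on the two players exchange their roles, and one crossing
    less remains.\<close>
  have "sep (rbp_size P ^ (r - 1)) (out w)" if w: "w \<in> W" for w
  proof -
    have "sep (rbp_size P ^ (r - 1)) (\<lambda>b a. bit_sign (label P (stop P ?N (X a b) y w)))"
    proof (rule less.IH)
      show "int g \<le> \<bar>int i - int j\<bar>" if "i \<in> J" "j \<in> I" for i j
        using less.prems(3)[OF that(2,1)] by linarith
    qed (use w crossing[OF w] less.prems in \<open>auto simp: W_def\<close>)
    from sep_swap[OF this] show ?thesis by (simp add: out_def[abs_def])
  qed
  then have "sep (rbp_size P ^ (r - 1)) (\<lambda>a b. of_bool (hit a = w) * 1 * out w a b)" if "w \<in> W" for w
    using sep_scale[of "rbp_size P ^ (r - 1)" "out w" "\<lambda>a. of_bool (hit a = w)" "\<lambda>_. 1"] that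
    by simp
  from sep_sum[OF fin this]
  have "sep (card W * rbp_size P ^ (r - 1)) (\<lambda>a b. \<Sum>w\<in>W. of_bool (hit a = w) * 1 * out w a b)" .
  \<comment> \<open>Besides one group of summands for each vertex of \<open>W\<close>, there is a
    single summand for the runs that terminate inside the territory of \<open>a\<close>.\<close>
  from sep_Suc[OF this, of "\<lambda>a. of_bool (hit a \<notin> ?N) * bit_sign (label P (hit a))" "\<lambda>_. 1"]
  have "sep (Suc (card W * rbp_size P ^ (r - 1))) (\<lambda>a b. (\<Sum>w\<in>W. of_bool (hit a = w) * out w a b) +
      of_bool (hit a \<notin> ?N) * bit_sign (label P (hit a)))"
    by simp
  moreover have "(\<Sum>w\<in>W. of_bool (hit a = w) * out w a b) +
      of_bool (hit a \<notin> ?N) * bit_sign (label P (hit a)) = out v a b" for a b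
  proof (cases "hit a \<in> ?N")
    case True
    have "(\<Sum>w\<in>W. of_bool (hit a = w) * out w a b) = (\<Sum>w\<in>W. if w = hit a then out w a b else 0)"
      by (intro sum.cong) auto
    with True hit_W[OF True] fin show ?thesis by (simp add: out_hit)
  next
    case False
    then have "hit a \<notin> W" by (auto simp: W_def)
    then have "(\<Sum>w\<in>W. of_bool (hit a = w) * out w a b) = 0"
      by (intro sum.neutral) auto
    with False hit_verts[of a] show ?thesis
      unfolding out_hit by (simp add: out_def stop_stopped)
  qed
  \<comment> \<open>The terminal vertex that is surely missing from \<open>W\<close> makes room for
    the extra summand: with \<open>s\<close> vertices, \<open>1 + card W * s ^ (r - 1)\<close> is at
    most \<open>(card W + 1) * s ^ (r - 1)\<close>, hence at most \<open>s ^ r\<close>.\<close>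
  moreover have "Suc (card W * rbp_size P ^ (r - 1)) \<le> rbp_size P ^ r"
  proof (cases r)
    case 0
    with crossing have "W = {}" by blast
    with 0 show ?thesis by simp
  next
    case (Suc r')
    have "W \<subseteq> ?N" by (auto simp: W_def)
    then have "Suc (card W) \<le> rbp_size P"
      using card_mono[of ?N W] card_nonterm finite_subset[OF nonterm_verts finite_verts] by linarith
    moreover from this have "1 \<le> rbp_size P ^ r'" by simp
    ultimately have "Suc (card W * rbp_size P ^ r') \<le> Suc (card W) * rbp_size P ^ r'"
      by simp
    also have "\<dots> \<le> rbp_size P * rbp_size P ^ r'"
      using \<open>Suc (card W) \<le> rbp_size P\<close> by (rule mult_le_mono1)
    finally show ?thesis by (simp add: Suc)
  qed
  ultimately show ?case
    using sep_mono by (simp add: out_def)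
qed

text \<open>The initial piece of the run outside \<open>I \<union> J\<close> depends on neither
  \<open>a\<close> nor \<open>b\<close>, so it ends in a fixed vertex \<open>w\<close>. If
  \<open>w\<close> is terminal the output is constant; otherwise \<open>w\<close> belongs to one of
  the players, who starts the game of \<open>sep_stop_side\<close>.\<close>

lemma sep_rbp_output:
  fixes X :: "bool list \<Rightarrow> bool list \<Rightarrow> bool list"
  assumes SR: "is_SR P" and g: "g > 0"
    and J: "\<And>a b b' i. i \<notin> J \<Longrightarrow> X a b ! i = X a b' ! i"
    and I: "\<And>a a' b i. i \<notin> I \<Longrightarrow> X a b ! i = X a' b ! i"
    and IJ: "\<And>i j. i \<in> I \<Longrightarrow> j \<in> J \<Longrightarrow> int g \<le> \<bar>int i - int j\<bar>"
    and r: "queries P \<le> (r + 1) * g"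
  shows "sep (rbp_size P ^ r) (\<lambda>a b. bit_sign (rbp_output P (X a b) y))"
proof -
  let ?N = "nonterm P"
  define U where "U = {u \<in> ?N. xvar P u \<notin> I \<union> J}"
  define w where "w = stop P U (X [] []) y (start P)"
  have U: "U \<subseteq> ?N" by (auto simp: U_def)
  have "stop P U (X a b) y (start P) = w" for a b
    unfolding w_def by (rule stop_cong[OF start_verts U]) (use I J in \<open>simp add: U_def, metis\<close>)
  then have out: "rbp_output P (X a b) y = label P (stop P ?N (X a b) y w)" for a b
    using stop_stop[OF start_verts U, of "X a b" y] by (simp add: rbp_output_stop)
  have w: "w \<in> verts P - U" unfolding w_def by (rule stop_verts[OF start_verts U])
  show ?thesis
  proof (cases "w \<in> ?N")
    case False
    then have "(\<lambda>a b. bit_sign (rbp_output P (X a b) y)) = (\<lambda>a b. bit_sign (label P w) * 1)"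
      using w by (simp add: out stop_stopped)
    moreover have "sep 1 (\<lambda>a b. bit_sign (label P w) * 1)"
      by (rule sep_1) auto
    moreover have "1 \<le> rbp_size P ^ r" using card_nonterm by (simp add: Suc_le_eq)
    ultimately show ?thesis using sep_mono by metis
  next
    case True
    have reach: "(start P, w) \<in> (edges P)\<^sup>*"
      unfolding w_def by (rule edges_stop[OF start_verts U])
    have "start P \<in> ?N"
      using reach True by (auto elim: converse_rtranclE simp: edges_def)
    then have "queries P > 0"
      using changes_less_queries[of "[start P]"] by (simp add: nonterm_path_def)
    have "limited (queries P - 1) (start P)"
      using changes_less_queries by (fastforce simp: limited_def)
    from limited_reachable[OF SR reach True this]
    have "limited (queries P - 1) w"
      by (auto simp: limited_def intro: order.trans)
    \<comment> \<open>The number of changes is one less than the number of queries, which turns the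
      bound on the queries into the strict inequality required of the budget.\<close>
    have Q: "queries P - 1 < (r + 1) * g"
      using r \<open>queries P > 0\<close> by linarith
    from w True have "xvar P w \<in> I \<or> xvar P w \<in> J" by (auto simp: U_def)
    then show ?thesis
    proof
      assume "xvar P w \<in> I"
      from sep_stop_side[OF SR g J I IJ True this \<open>limited (queries P - 1) w\<close> Q, where y = y]
      show ?thesis by (simp add: out)
    next
      assume "xvar P w \<in> J"
      have "sep (rbp_size P ^ r) (\<lambda>b a. bit_sign (label P (stop P ?N (X a b) y w)))"
      proof (rule sep_stop_side[OF SR g])
        show "int g \<le> \<bar>int i - int j\<bar>" if "i \<in> J" "j \<in> I" for i j
          using IJ[OF that(2,1)] by linarith
      qed (use I J True \<open>xvar P w \<in> J\<close> \<open>limited (queries P - 1) w\<close> Q in auto)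
      from sep_swap[OF this] show ?thesis by (simp add: out)
    qed
  qed
qed

end

section \<open>The block extractor\<close>

definition block :: "nat \<Rightarrow> nat \<Rightarrow> bool list \<Rightarrow> bool list" where
  "block k j x = take k (drop (j * k) x)"

definition block_ip :: "nat \<Rightarrow> bool list \<Rightarrow> nat \<Rightarrow> bool" where
  "block_ip k x j = ip (block k j x) (block k j (rev x))"

definition extractor :: "nat \<Rightarrow> nat \<Rightarrow> bool list \<Rightarrow> bool list" where
  "extractor n m x = map (block_ip (n div (3 * m)) x) [0..<m]"

lemma block_append1: "length u = j * k \<Longrightarrow> i < j \<Longrightarrow> block k i (u @ v) = block k i u"
proof -
  assume u: "length u = j * k" and "i < j"
  then have "i * k + k \<le> length u"
    using mult_le_mono1[of "Suc i" j k] by simp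
  then show ?thesis by (simp add: block_def)
qed

lemma block_append2: "length u = j * k \<Longrightarrow> length a = k \<Longrightarrow> block k j (u @ a @ v) = a"
  by (simp add: block_def)

text \<open>Earlier bits of the extractor see only the outermost \<open>j * k\<close> positions on
  each side. They are therefore constant while the \<open>j\<close>-th blocks vary, which is what
  the bitwise replacement rests on.\<close>

lemma block_ip_outside:
  assumes "length u = j * k" "length w = j * k" "i < j"
  shows "block_ip k (u @ v @ w) i = ip (block k i u) (block k i (rev w))"
  using block_append1[of u j k i "v @ w"] block_append1[of "rev w" j k i "rev v @ rev u"] assms
  by (simp add: block_ip_def)

lemma block_ip_inside:
  assumes "length u = j * k" "length w = j * k" "length a = k" "length b = k"
  shows "block_ip k (u @ a @ v @ b @ w) j = ip a (rev b)"
  using assms by (simp add: block_ip_def block_append2)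

lemma abs_sum_le:
  fixes F :: "'a \<Rightarrow> real"
  assumes "\<And>x. x \<in> A \<Longrightarrow> \<bar>F x\<bar> \<le> c"
  shows "\<bar>\<Sum>x\<in>A. F x\<bar> \<le> real (card A) * c"
  using assms by (intro order.trans[OF sum_abs sum_bounded_above])

section \<open>Replacing the random bits one at a time\<close>

context branching_program
begin

definition disagree :: "bool list \<Rightarrow> bool list \<Rightarrow> bool list \<Rightarrow> real" where
  "disagree z y x = of_bool (rbp_output P x y \<noteq> rbp_output P x z)"

lemma disagree_sign:
  "disagree z y x = (1 - bit_sign (rbp_output P x y) * bit_sign (rbp_output P x z)) / 2"
  by (auto simp: disagree_def bit_sign_def)

text \<open>The decrease of \<open>disagree\<close> when a uniform bit between \<open>s\<close> and
  \<open>t\<close> is replaced by \<open>c\<close>.\<close>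

definition bit_gap :: "bool list \<Rightarrow> bool list \<Rightarrow> bool list \<Rightarrow> bool list \<Rightarrow> bool \<Rightarrow> real" where
  "bit_gap z s t x c =
     (disagree z (s @ False # t) x + disagree z (s @ True # t) x) / 2 - disagree z (s @ c # t) x"

text \<open>The average of two values differs from either of them by half their difference, up to
  the sign. The gap thus becomes a correlation with \<open>bit_sign c\<close>.\<close>

lemma bit_gap_sign:
  "bit_gap z s t x c = bit_sign c * ((bit_sign (rbp_output P x (s @ False # t)) +
     (-1) * bit_sign (rbp_output P x (s @ True # t))) * bit_sign (rbp_output P x z)) / 4"
  by (cases c) (auto simp: bit_gap_def disagree_sign field_simps)

text \<open>Each output sign is a sum of \<open>N = rbp_size P ^ r\<close> products of a function of
  \<open>a\<close> and a function of \<open>b\<close>. The difference of two of them times a third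
  one has \<open>2 * N * N\<close> summands, and the factor \<open>1 / 4\<close> of
  \<open>bit_gap_sign\<close> leaves half of \<open>N * N\<close>.\<close>

lemma abs_sum_bit_gap_block:
  assumes SR: "is_SR P" and g: "0 < g" "g \<le> length v" and r: "queries P \<le> (r + 1) * g"
  shows "\<bar>\<Sum>a\<in>bits k. \<Sum>b\<in>bits k. bit_gap z s t (u @ a @ v @ b @ w) (ip a (rev b))\<bar>
    \<le> (real (rbp_size P) ^ r)\<^sup>2 * sqrt (8 ^ k) / 2"
proof -
  \<comment> \<open>The predicate \<open>sep\<close> ranges over strings of every length. Replacing
    those of a wrong length keeps the positions of the two blocks in \<open>X a b\<close>
    fixed.\<close>
  define fit where "fit a = (if length a = k then a else replicate k False)" for a
  define X where "X a b = u @ fit a @ v @ fit b @ w" for a b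
  define N where "N = rbp_size P ^ r"
  define \<rho> where "\<rho> y a b = bit_sign (rbp_output P (X a b) y)" for y a b
  have fit: "length (fit a) = k" for a by (simp add: fit_def)
  let ?I = "{length u..<length u + k}"
  let ?J = "{length u + k + length v..<length u + k + length v + k}"
  have X: "X a b ! i = (if i < length u then u ! i else if i < length u + k then fit a ! (i - length u)
     else if i < length u + k + length v then v ! (i - length u - k)
     else if i < length u + k + length v + k then fit b ! (i - length u - k - length v)
     else w ! (i - length u - k - length v - k))" for a b i
    by (simp add: X_def nth_append fit algebra_simps) auto
  have "sep N (\<rho> y)" for y
    unfolding N_def \<rho>_def
  proof (rule sep_rbp_output[OF SR g(1) _ _ _ r])
    show "X a b ! i = X a b' ! i" if "i \<notin> ?J" for a b b' i
      using that by (simp add: X)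
    show "X a b ! i = X a' b ! i" if "i \<notin> ?I" for a a' b i
      using that by (auto simp: X)
    show "int g \<le> \<bar>int i - int j\<bar>" if "i \<in> ?I" "j \<in> ?J" for i j
      using that g by auto
  qed
  then have "sep ((N + N) * N) (\<lambda>a b. (\<rho> (s @ False # t) a b + (-1) * 1 * \<rho> (s @ True # t) a b) * \<rho> z a b)"
    using sep_scale[of N _ "\<lambda>_. -1" "\<lambda>_. 1"] by (intro sep_mult sep_add) auto
  from abs_sum_sign_ip_sep_le[OF this, of k]
  have "\<bar>\<Sum>a\<in>bits k. \<Sum>b\<in>bits k. bit_sign (ip a (rev b)) *
      ((\<rho> (s @ False # t) a b + (-1) * \<rho> (s @ True # t) a b) * \<rho> z a b)\<bar> / 4
    \<le> (real (rbp_size P) ^ r)\<^sup>2 * sqrt (8 ^ k) / 2"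
    by (simp add: N_def power2_eq_square field_simps)
  moreover have "(\<Sum>a\<in>bits k. \<Sum>b\<in>bits k. bit_gap z s t (u @ a @ v @ b @ w) (ip a (rev b))) =
    (\<Sum>a\<in>bits k. \<Sum>b\<in>bits k. bit_sign (ip a (rev b)) *
      ((\<rho> (s @ False # t) a b + (-1) * \<rho> (s @ True # t) a b) * \<rho> z a b)) / 4"
    unfolding sum_divide_distrib
    by (intro sum.cong refl)
      (simp add: bit_gap_sign \<rho>_def X_def fit_def bits_def)
  ultimately show ?thesis by (simp add: abs_divide)
qed

text \<open>With everything but the two \<open>j\<close>-th blocks fixed, the earlier extractor bits
  are constant and the bound for one pair of blocks applies. It is then summed over the remaining
  parts of \<open>x\<close>.\<close>

lemma abs_sum_bit_gap:
  assumes SR: "is_SR P" and "j < l" and g: "0 < g" "g + 2 * (l * k) \<le> n"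
    and r: "queries P \<le> (r + 1) * g"
  shows "\<bar>\<Sum>x\<in>bits n. bit_gap z (map (block_ip k x) [0..<j]) t x (block_ip k x j)\<bar>
    \<le> 2 ^ n * ((real (rbp_size P) ^ r)\<^sup>2 * sqrt (8 ^ k) / 4 ^ k / 2)"
proof -
  let ?p = "j * k"
  \<comment> \<open>The string is split as \<open>u @ a @ v @ b @ w\<close>, where \<open>a\<close>
    and \<open>b\<close> are the \<open>j\<close>-th blocks and \<open>q\<close> is the length of
    \<open>v\<close>. For every \<open>j\<close> below \<open>l\<close> the gap has at least
    \<open>g\<close> positions.\<close>
  define q where "q = n - 2 * ?p - 2 * k"
  define c where "c = (real (rbp_size P) ^ r)\<^sup>2 * sqrt (8 ^ k) / 2"
  have jl: "?p + k \<le> l * k" using mult_le_mono1[of "Suc j" l k] \<open>j < l\<close> by simp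
  have n: "n = ?p + (k + (q + (k + ?p)))" and "g \<le> q"
    using g jl by (simp_all add: q_def)
  define G where "G u a v b w = bit_gap z (map (\<lambda>i. ip (block k i u) (block k i (rev w))) [0..<j]) t
     (u @ a @ v @ b @ w) (ip a (rev b))" for u a v b w
  have "(\<Sum>x\<in>bits n. bit_gap z (map (block_ip k x) [0..<j]) t x (block_ip k x j)) =
    (\<Sum>u\<in>bits ?p. \<Sum>a\<in>bits k. \<Sum>v\<in>bits q. \<Sum>b\<in>bits k. \<Sum>w\<in>bits ?p. G u a v b w)"
    unfolding n sum_bits_append G_def
  proof (intro sum.cong refl)
    fix u a v b w assume *: "u \<in> bits ?p" "a \<in> bits k" "v \<in> bits q" "b \<in> bits k" "w \<in> bits ?p"
    then have eq: "map (block_ip k (u @ a @ v @ b @ w)) [0..<j] =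
        map (\<lambda>i. ip (block k i u) (block k i (rev w))) [0..<j]"
      using block_ip_outside[of u j k w _ "a @ v @ b"] by (auto simp: length_bits)
    have "block_ip k (u @ a @ v @ b @ w) j = ip a (rev b)"
      using * by (intro block_ip_inside) (simp_all add: length_bits)
    with eq show "bit_gap z (map (block_ip k (u @ a @ v @ b @ w)) [0..<j]) t
        (u @ a @ v @ b @ w) (block_ip k (u @ a @ v @ b @ w) j) =
      bit_gap z (map (\<lambda>i. ip (block k i u) (block k i (rev w))) [0..<j]) t
        (u @ a @ v @ b @ w) (ip a (rev b))"
      by (simp only:)
  qed
  also have "\<dots> = (\<Sum>u\<in>bits ?p. \<Sum>v\<in>bits q. \<Sum>w\<in>bits ?p. \<Sum>a\<in>bits k. \<Sum>b\<in>bits k. G u a v b w)"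
  proof (rule sum.cong[OF refl])
    fix u
    have "(\<Sum>a\<in>bits k. \<Sum>v\<in>bits q. \<Sum>b\<in>bits k. \<Sum>w\<in>bits ?p. G u a v b w) =
        (\<Sum>v\<in>bits q. \<Sum>a\<in>bits k. \<Sum>b\<in>bits k. \<Sum>w\<in>bits ?p. G u a v b w)"
      by (rule sum.swap)
    also have "\<dots> = (\<Sum>v\<in>bits q. \<Sum>a\<in>bits k. \<Sum>w\<in>bits ?p. \<Sum>b\<in>bits k. G u a v b w)"
      by (intro sum.cong refl sum.swap)
    also have "\<dots> = (\<Sum>v\<in>bits q. \<Sum>w\<in>bits ?p. \<Sum>a\<in>bits k. \<Sum>b\<in>bits k. G u a v b w)"
      by (intro sum.cong refl sum.swap)
    finally show "(\<Sum>a\<in>bits k. \<Sum>v\<in>bits q. \<Sum>b\<in>bits k. \<Sum>w\<in>bits ?p. G u a v b w) =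
      (\<Sum>v\<in>bits q. \<Sum>w\<in>bits ?p. \<Sum>a\<in>bits k. \<Sum>b\<in>bits k. G u a v b w)" .
  qed
  also have "\<bar>\<dots>\<bar> \<le> 2 ^ ?p * (2 ^ q * (2 ^ ?p * c))"
  proof -
    have "\<bar>\<Sum>a\<in>bits k. \<Sum>b\<in>bits k. G u a v b w\<bar> \<le> c" if "v \<in> bits q" for u v w
      unfolding G_def c_def
      by (rule abs_sum_bit_gap_block[OF SR g(1) _ r]) (use that \<open>g \<le> q\<close> in \<open>simp add: length_bits\<close>)
    then have "\<bar>\<Sum>w\<in>bits ?p. \<Sum>a\<in>bits k. \<Sum>b\<in>bits k. G u a v b w\<bar> \<le> 2 ^ ?p * c"
      if "v \<in> bits q" for u v
      using abs_sum_le[of "bits ?p" "\<lambda>w. \<Sum>a\<in>bits k. \<Sum>b\<in>bits k. G u a v b w" c] that by simp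
    then have "\<bar>\<Sum>v\<in>bits q. \<Sum>w\<in>bits ?p. \<Sum>a\<in>bits k. \<Sum>b\<in>bits k. G u a v b w\<bar> \<le> 2 ^ q * (2 ^ ?p * c)"
      for u
      using abs_sum_le[of "bits q" "\<lambda>v. \<Sum>w\<in>bits ?p. \<Sum>a\<in>bits k. \<Sum>b\<in>bits k. G u a v b w" "2 ^ ?p * c"]
      by simp
    then show ?thesis
      using abs_sum_le[of "bits ?p" _ "2 ^ q * (2 ^ ?p * c)"] by simp
  qed
  also have "2 ^ ?p * (2 ^ q * (2 ^ ?p * c)) =
      2 ^ n * ((real (rbp_size P) ^ r)\<^sup>2 * sqrt (8 ^ k) / 4 ^ k / 2)"
  \<comment> \<open>The sums over \<open>u\<close>, \<open>v\<close> and \<open>w\<close> have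
    \<open>2 ^ n / 4 ^ k\<close> terms, as the two blocks account for \<open>2 * k\<close>
    positions.\<close>
  proof -
    have "(4::real) ^ k = 2 ^ k * 2 ^ k" by (simp flip: power_mult_distrib)
    moreover have "(2::real) ^ n = 2 ^ ?p * (2 ^ k * (2 ^ q * (2 ^ k * 2 ^ ?p)))"
      by (subst n) (simp only: power_add)
    ultimately show ?thesis by (simp add: c_def)
  qed
  finally show ?thesis .
qed

text \<open>A telescoping hybrid argument: neighbouring hybrids differ by the average of
  \<open>bit_gap\<close> over the bits \<open>t\<close> that are still uniform, and for each fixed
  \<open>t\<close> the assumption bounds its sum over \<open>x\<close>.\<close>

lemma hybrid:
  assumes step: "\<And>j t. j < m \<Longrightarrow>
      \<bar>\<Sum>x\<in>bits n. bit_gap z (map (\<beta> x) [0..<j]) t x (\<beta> x j)\<bar> \<le> 2 ^ n * \<epsilon>"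
  shows "(\<Sum>x\<in>bits n. disagree z (map (\<beta> x) [0..<m]) x) \<le>
    (\<Sum>x\<in>bits n. \<Sum>y\<in>bits m. disagree z y x) / 2 ^ m + real m * (2 ^ n * \<epsilon>)"
proof -
  \<comment> \<open>In \<open>H j\<close> the first \<open>j\<close> bits come from \<beta> and the
    others are uniform, so \<open>H 0\<close> is the fully random case and \<open>H m\<close> the
    target.\<close>
  define H where "H j = (\<Sum>x\<in>bits n. \<Sum>t\<in>bits (m - j).
     disagree z (map (\<beta> x) [0..<j] @ t) x) / 2 ^ (m - j)" for j
  have "H (Suc j) \<le> H j + 2 ^ n * \<epsilon>" if "j < m" for j
  proof -
    define l where "l = m - Suc j"
    have l: "m - j = Suc l" using that by (simp add: l_def)
    have "H j - H (Suc j) = (\<Sum>x\<in>bits n. \<Sum>t\<in>bits l.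
        bit_gap z (map (\<beta> x) [0..<j]) t x (\<beta> x j)) / 2 ^ l"
      unfolding H_def l l_def[symmetric]
      by (simp add: sum_bits_Suc bit_gap_def sum_subtractf sum.distrib sum_divide_distrib[symmetric]
          sum_distrib_left[symmetric] field_simps)
    also have "\<dots> = (\<Sum>t\<in>bits l. \<Sum>x\<in>bits n.
        bit_gap z (map (\<beta> x) [0..<j]) t x (\<beta> x j)) / 2 ^ l"
      by (subst sum.swap) simp
    also have "\<bar>\<dots>\<bar> \<le> real (card (bits l)) * (2 ^ n * \<epsilon>) / 2 ^ l"
      unfolding abs_divide using step[OF that]
      by (intro divide_mono abs_sum_le) auto
    finally show ?thesis by (simp add: abs_le_iff)
  qed
  then have "H j \<le> H 0 + real j * (2 ^ n * \<epsilon>)" if "j \<le> m" for j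
    using that
  proof (induction j)
    case (Suc j)
    then have "H (Suc j) \<le> H j + 2 ^ n * \<epsilon>" "H j \<le> H 0 + real j * (2 ^ n * \<epsilon>)" by auto
    then show ?case by (simp add: algebra_simps)
  qed simp
  from this[of m] show ?thesis by (simp add: H_def)
qed

end

section \<open>The constant and the error bound\<close>

text \<open>Write \<open>t = n / m\<close>. The distance between paired blocks is at least
  \<open>n / 3\<close>, so a constant \<alpha> in the assumption bounds \<open>r * log 2 s\<close>
  by \<open>3 * \<alpha> * t\<close>. As \<open>k\<close> is at least \<open>t / 6\<close>, the
  exponent \<open>2 * r * log 2 s - k / 2 - 1\<close> is below
  \<open>(6 * \<alpha> - 1 / 12) * t\<close>, which is at most \<open>- \<alpha> * t\<close> once
  \<alpha> \<le> \<open>1 / 84\<close>; the value \<open>1 / 100\<close> satisfies this.\<close>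

lemma block_error_bound:
  assumes "1 \<le> m" "3 * m \<le> n" "1 \<le> s"
    and TS: "real T * real_of_int \<lceil>log 2 (real s)\<rceil> * real m \<le> 1 / 100 * (real n)\<^sup>2"
    and k: "k = n div (3 * m)"
  shows "(real s ^ (T div (n - 2 * (m * k))))\<^sup>2 * sqrt (8 ^ k) / 4 ^ k / 2
    \<le> 2 powr (- (1 / 100) * real n / real m)"
proof -
  define r where "r = T div (n - 2 * (m * k))"
  define S where "S = real_of_int \<lceil>log 2 (real s)\<rceil>"
  define t where "t = real n / real m"
  have n: "0 < real n" and m: "0 < real m" using assms by auto
  have log: "0 \<le> log 2 (real s)" "log 2 (real s) \<le> S"
    using assms by (simp_all add: S_def)
  have "3 * m * k \<le> n"
    using div_times_less_eq_dividend[of n "3 * m"] by (simp add: k mult.commute)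
  then have "n \<le> 3 * (n - 2 * (m * k))"
    by simp
  then have g: "real n / 3 \<le> real (n - 2 * (m * k))"
    by linarith
  have "real r \<le> real T / real (n - 2 * (m * k))"
    unfolding r_def by (rule of_nat_div_le_of_nat)
  also have "\<dots> \<le> real T / (real n / 3)"
    by (rule frac_le) (use n in simp, simp, use n in simp, rule g)
  also have "\<dots> = 3 * real T / real n" by simp
  finally have r: "real r \<le> 3 * real T / real n" .
  have "real r * log 2 (real s) \<le> 3 * real T / real n * S"
    using r log by (intro mult_mono) auto
  also have "\<dots> = 3 * (real T * S * real m) / (real n * real m)" using n m by simp
  also have "\<dots> \<le> 3 * (1 / 100 * (real n)\<^sup>2) / (real n * real m)"
    using TS n m by (intro divide_right_mono mult_left_mono) (auto simp: S_def)
  also have "\<dots> = 3 / 100 * t" using n m by (simp add: t_def power2_eq_square)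
  finally have rs: "real r * log 2 (real s) \<le> 3 / 100 * t" .
  \<comment> \<open>Since \<open>k\<close> is positive, rounding down in its definition costs at
    most a factor of 2.\<close>
  have "0 < k" using assms unfolding k by (subst div_greater_zero_iff) auto
  have "n < 3 * m * (k + 1)"
    unfolding k using dividend_less_times_div[of "3 * m" n] assms(1) by simp
  then have "real n < real (3 * m * (k + 1))" by (simp only: of_nat_less_iff)
  also have "\<dots> \<le> 3 * real m * (2 * real k)"
    using \<open>0 < k\<close> m by simp
  finally have kt: "t \<le> 6 * real k" using m by (simp add: t_def field_simps)
  have pow: "(2 powr a) ^ i = 2 powr (a * real i)" for a :: real and i
    by (subst powr_power) (auto simp: mult.commute)
  have "real s ^ r = 2 powr (real r * log 2 (real s))"
    using pow[of "log 2 (real s)" r] assms(3) by (subst mult.commute) simp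
  moreover have "sqrt (8 ^ k) = 2 powr (3 * real k / 2)"
  proof -
    have "(8::real) ^ k = 2 powr (3 * real k)" using pow[of 3 k] by simp
    also have "\<dots> = (2 powr (3 * real k / 2))\<^sup>2" by (simp add: power2_eq_square flip: powr_add)
    finally show ?thesis by simp
  qed
  moreover have "(4::real) ^ k = 2 powr (2 * real k)"
    using pow[of 2 k] by simp
  moreover have "(2 powr a)\<^sup>2 * 2 powr b / 2 powr c / 2 = 2 powr (a + a + b - c - 1)" for a b c :: real
    by (simp only: powr_add powr_diff power2_eq_square powr_one)
  ultimately have "(real s ^ r)\<^sup>2 * sqrt (8 ^ k) / 4 ^ k / 2 = 2 powr (real r * log 2 (real s) +
      real r * log 2 (real s) + 3 * real k / 2 - 2 * real k - 1)"
    by simp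
  also have "\<dots> \<le> 2 powr (- (1 / 100) * t)"
    using rs kt \<open>0 < k\<close> by (intro powr_mono) auto
  finally show ?thesis by (simp add: r_def t_def)
qed

lemma sum_failures_le:
  assumes "computes_with_failure n m P f \<delta>" "x \<in> bits n"
  shows "(\<Sum>y\<in>bits m. of_bool (rbp_output P x y \<noteq> f x)) \<le> \<delta> * 2 ^ m"
proof -
  have "1 - \<delta> \<le> real (card (bits m \<inter> {y. rbp_output P x y = f x})) / 2 ^ m"
    using assms by (simp add: computes_with_failure_def measure_pmf_of_set)
  then have "2 ^ m - \<delta> * 2 ^ m \<le> real (card (bits m \<inter> {y. rbp_output P x y = f x}))"
    by (simp add: field_simps)
  also have "\<dots> = (\<Sum>y\<in>bits m. of_bool (rbp_output P x y = f x))"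
    by (simp add: of_bool_def flip: sum.inter_filter) (simp add: Int_def)
  also have "\<dots> = (\<Sum>y\<in>bits m. 1 - of_bool (rbp_output P x y \<noteq> f x))"
    by (intro sum.cong) auto
  finally show ?thesis by (simp add: sum_subtractf)
qed

text \<open>A wrong output on the extracted string means a disagreement with the output on
  \<open>z\<close> or an error on \<open>z\<close> itself. The hybrid argument compares the
  disagreement with that of a uniform \<open>y\<close>.\<close>

lemma extractor_error:
  assumes "1 \<le> m" "3 * m \<le> n" and P: "is_rbp n m P" "is_SR P"
    and comp: "computes_with_failure n m P f \<delta>"
    and TS: "real (queries P) * real_of_int \<lceil>log 2 (real (rbp_size P))\<rceil> * real m
      \<le> 1 / 100 * (real n)\<^sup>2"
  shows "cube_density n {x\<in>bits n. rbp_output P x (extractor n m x) \<noteq> f x}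
    \<le> 3 * \<delta> + real m * 2 powr (- (1 / 100) * real n / real m)"
proof -
  interpret branching_program n m P by unfold_locales (rule P)
  define k where "k = n div (3 * m)"
  define g where "g = n - 2 * (m * k)"
  define \<epsilon> where "\<epsilon> = 2 powr (- (1 / 100) * real n / real m)"
  define err :: "bool list \<Rightarrow> bool list \<Rightarrow> real" where
    "err x y = of_bool (rbp_output P x y \<noteq> f x)" for x y
  have err: "(\<Sum>y\<in>bits m. err x y) \<le> \<delta> * 2 ^ m" if "x \<in> bits n" for x
    using sum_failures_le[OF comp that] by (simp add: err_def)
  have err2: "(\<Sum>x\<in>bits n. \<Sum>y\<in>bits m. err x y) \<le> 2 ^ n * (\<delta> * 2 ^ m)"
    using sum_bounded_above[of "bits n" _ "\<delta> * 2 ^ m"] err by simp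
  \<comment> \<open>Averaging over \<open>y\<close>: some string does at least as well as the mean
    over all inputs.\<close>
  have "\<exists>z\<in>bits m. (\<Sum>x\<in>bits n. err x z) \<le> 2 ^ n * \<delta>"
  proof (rule ccontr)
    assume "\<not> ?thesis"
    then have "(\<Sum>z\<in>bits m. 2 ^ n * \<delta>) < (\<Sum>z\<in>bits m. \<Sum>x\<in>bits n. err x z)"
      by (intro sum_strict_mono) auto
    also have "\<dots> = (\<Sum>x\<in>bits n. \<Sum>y\<in>bits m. err x y)" by (rule sum.swap)
    finally show False using err2 by (simp add: algebra_simps)
  qed
  then obtain z where z: "(\<Sum>x\<in>bits n. err x z) \<le> 2 ^ n * \<delta>" by blast
  have "3 * m * k \<le> n"
    using div_times_less_eq_dividend[of n "3 * m"] by (simp add: k_def mult.commute)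
  then have g: "0 < g" "g + 2 * (m * k) \<le> n"
    using assms(1,2) by (auto simp: g_def)
  have queries: "queries P \<le> (queries P div g + 1) * g"
    using dividend_less_times_div[OF g(1), of "queries P"] by (simp add: mult.commute)
  have \<epsilon>: "(real (rbp_size P) ^ (queries P div g))\<^sup>2 * sqrt (8 ^ k) / 4 ^ k / 2 \<le> \<epsilon>"
    unfolding g_def \<epsilon>_def
    by (rule block_error_bound[OF assms(1,2) _ TS k_def]) (use card_nonterm in linarith)
  have hyb: "(\<Sum>x\<in>bits n. disagree z (extractor n m x) x) \<le>
      (\<Sum>x\<in>bits n. \<Sum>y\<in>bits m. disagree z y x) / 2 ^ m + real m * (2 ^ n * \<epsilon>)"
    unfolding extractor_def k_def[symmetric]
  proof (rule hybrid)
    fix j t assume "j < m"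
    show "\<bar>\<Sum>x\<in>bits n. bit_gap z (map (block_ip k x) [0..<j]) t x (block_ip k x j)\<bar> \<le> 2 ^ n * \<epsilon>"
      using abs_sum_bit_gap[OF P(2) \<open>j < m\<close> g queries, of z t] \<epsilon>
      by (meson mult_left_mono order.trans zero_le_numeral zero_le_power)
  qed
  \<comment> \<open>If two output bits disagree, one of them is wrong, and each of the two errors
    contributes at most \<delta>.\<close>
  have "(\<Sum>y\<in>bits m. disagree z y x) \<le> (\<Sum>y\<in>bits m. err x y + err x z)" for x
    by (intro sum_mono) (auto simp: disagree_def err_def)
  then have "(\<Sum>x\<in>bits n. \<Sum>y\<in>bits m. disagree z y x) \<le>
      (\<Sum>x\<in>bits n. (\<Sum>y\<in>bits m. err x y) + 2 ^ m * err x z)"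
    by (intro sum_mono) (simp add: sum.distrib)
  also have "\<dots> \<le> 2 ^ n * (\<delta> * 2 ^ m) + 2 ^ m * (2 ^ n * \<delta>)"
    unfolding sum.distrib sum_distrib_left[symmetric]
    using err2 z by (intro add_mono mult_left_mono) auto
  finally have uniform: "(\<Sum>x\<in>bits n. \<Sum>y\<in>bits m. disagree z y x) / 2 ^ m \<le> 2 ^ n * (2 * \<delta>)"
    by (simp add: field_simps)
  have "real (card {x\<in>bits n. rbp_output P x (extractor n m x) \<noteq> f x}) =
      (\<Sum>x\<in>bits n. err x (extractor n m x))"
    by (simp add: err_def of_bool_def flip: sum.inter_filter)
  also have "\<dots> \<le> (\<Sum>x\<in>bits n. disagree z (extractor n m x) x + err x z)"
    by (intro sum_mono) (auto simp: disagree_def err_def)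
  also have "\<dots> \<le> 2 ^ n * (3 * \<delta> + real m * \<epsilon>)"
    using hyb uniform z by (simp add: sum.distrib algebra_simps)
  finally show ?thesis
    by (simp add: cube_density_def \<epsilon>_def divide_le_eq mult.commute)
qed

section \<open>Counter machines\<close>

text \<open>An \<open>Io\<close> instruction combines every access to the input and output tapes:
  the scanned symbol determines the jump, the move of the input head and the bit that is
  written.\<close>

datatype instr =
    Inc nat nat
  | Dec nat nat nat
  | Io "in_symbol \<Rightarrow> nat \<times> direction \<times> bool option"
  | Stop

type_synonym cconfig = "nat \<times> nat \<times> nat list \<times> bool list"

text \<open>
  \<open>Dec t a b\<close> jumps to \<open>b\<close> if counter \<open>t\<close> is zero, and otherwise decrements it and jumps to
  \<open>a\<close>. Counters have to stay below \<open>2 ^ B\<close>; the machine gets stuck on overflow.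
\<close>
fun cnext :: "instr list \<Rightarrow> in_symbol list \<Rightarrow> nat \<Rightarrow> cconfig \<Rightarrow> cconfig option" where
  "cnext code w B (pc, p, vs, out) =
    (case code ! pc of
      Inc t a \<Rightarrow> if Suc (vs ! t) < 2 ^ B then Some (a, p, vs[t := Suc (vs ! t)], out) else None
    | Dec t a b \<Rightarrow> if vs ! t = 0 then Some (b, p, vs, out) else Some (a, p, vs[t := vs ! t - 1], out)
    | Io h \<Rightarrow> (case h (scanned w p) of (a, d, ob) \<Rightarrow>
        Some (a, min (move d p) (length w + 1), vs, out @ (case ob of None \<Rightarrow> [] | Some b \<Rightarrow> [b])))
    | Stop \<Rightarrow> None)"

definition cexec :: "instr list \<Rightarrow> in_symbol list \<Rightarrow> nat \<Rightarrow> cconfig \<Rightarrow> cconfig \<Rightarrow> bool" where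
  "cexec code w B = (\<lambda>c c'. cnext code w B c = Some c')\<^sup>*\<^sup>*"

lemma cexec_refl: "cexec code w B c c"
  by (simp add: cexec_def)

lemma cexec_step: "cnext code w B c = Some c' \<Longrightarrow> cexec code w B c' c'' \<Longrightarrow> cexec code w B c c''"
  unfolding cexec_def by (rule converse_rtranclp_into_rtranclp)

lemma cexec_trans [trans]: "cexec code w B c c' \<Longrightarrow> cexec code w B c' c'' \<Longrightarrow> cexec code w B c c''"
  unfolding cexec_def by (rule rtranclp_trans)

fun valid_instr :: "nat \<Rightarrow> nat \<Rightarrow> instr \<Rightarrow> bool" where
  "valid_instr N c (Inc t a) \<longleftrightarrow> t < c \<and> a < N"
| "valid_instr N c (Dec t a b) \<longleftrightarrow> t < c \<and> a < N \<and> b < N"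
| "valid_instr N c (Io h) \<longleftrightarrow> (\<forall>s. fst (h s) < N)"
| "valid_instr N c Stop \<longleftrightarrow> True"

section \<open>Binary counters on work tapes\<close>

text \<open>
  Least significant bit first, leading zeros allowed. Cell 0 holds the marker 3, the digits are
  written as 1 and 2, so that the blank 0 marks the end of the number.
\<close>

fun val :: "bool list \<Rightarrow> nat" where
  "val [] = 0"
| "val (b # ds) = of_bool b + 2 * val ds"

fun inc :: "bool list \<Rightarrow> bool list" where
  "inc [] = [True]"
| "inc (False # ds) = True # ds"
| "inc (True # ds) = False # inc ds"

fun dec :: "bool list \<Rightarrow> bool list option" where
  "dec [] = None"
| "dec (True # ds) = Some (False # ds)"
| "dec (False # ds) = map_option ((#) True) (dec ds)"

lemma val_inc: "val (inc ds) = Suc (val ds)"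
  by (induction ds rule: inc.induct) auto

text \<open>Because of leading zeros the length is not determined by the value. An increment
  lengthens only a string of ones, and such a string of length \<open>B\<close> has value
  \<open>2 ^ B - 1\<close>, which the assumption excludes.\<close>

lemma length_inc: "length ds \<le> B \<Longrightarrow> Suc (val ds) < 2 ^ B \<Longrightarrow> length (inc ds) \<le> B"
proof (induction ds arbitrary: B rule: inc.induct)
  case (3 ds)
  then show ?case by (cases B) auto
qed (auto simp: Suc_le_eq intro: gr0I)

lemma dec_Some: "dec ds = Some ds' \<Longrightarrow> val ds = Suc (val ds') \<and> length ds' = length ds"
  by (induction ds arbitrary: ds' rule: dec.induct) auto

lemma dec_None: "dec ds = None \<Longrightarrow> ds = replicate (length ds) False"
  by (induction ds rule: dec.induct) auto

lemma val_zeros: "val (replicate n False) = 0"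
  by (induction n) auto

definition digit :: "bool \<Rightarrow> nat" where
  "digit b = (if b then 2 else 1)"

lemma digit_eq [simp]: "digit a = digit b \<longleftrightarrow> a = b" "digit b \<noteq> 3" "digit b \<noteq> 0" "0 \<noteq> digit b"
  by (simp_all add: digit_def)

definition ctape :: "bool list \<Rightarrow> nat \<Rightarrow> nat" where
  "ctape ds p = (if p = 0 then 3 else if p \<le> length ds then digit (ds ! (p - 1)) else 0)"

lemma ctape_0 [simp]: "ctape ds 0 = 3"
  by (simp add: ctape_def)

lemma ctape_nth [simp]: "ctape (us @ b # ds) (Suc (length us)) = digit b"
  by (simp add: ctape_def)

lemma ctape_end [simp]: "ctape us (Suc (length us)) = 0"
  by (simp add: ctape_def)

lemma ctape_upd [simp]: "(ctape (us @ b # ds))(Suc (length us) := digit c) = ctape (us @ c # ds)"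
  by (rule ext) (auto simp: ctape_def nth_append nth_Cons')

lemma ctape_upd_end [simp]: "(ctape us)(Suc (length us) := digit c) = ctape (us @ [c])"
  by (rule ext) (auto simp: ctape_def nth_append)

section \<open>Simulation of counter machines by Turing machines\<close>

text \<open>A step of the machine writes on every work tape, so resting means writing back the
  scanned symbol.\<close>

definition idle :: "nat list \<Rightarrow> (nat \<times> direction) list" where
  "idle ws = map (\<lambda>s. (s, Stay)) ws"

definition act :: "nat list \<Rightarrow> nat \<Rightarrow> nat \<Rightarrow> direction \<Rightarrow> (nat \<times> direction) list" where
  "act ws t s d = (idle ws)[t := (s, d)]"

text \<open>Four phases for each instruction. State 0 is left free for the initial step, which
  writes the marker into cell 0 of every work tape.\<close>

definition st :: "nat \<Rightarrow> nat \<Rightarrow> nat" where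
  "st pc ph = Suc (4 * pc + ph)"

text \<open>
  An instruction is executed in phases: in phase 1 the head on the tape of the counter moves to
  the right while carrying, and it returns in phase 2, or in phase 3 after the attempt to
  decrement zero, which has turned all digits to 1.
\<close>
fun compile_instr :: "instr \<Rightarrow> nat \<Rightarrow> nat \<Rightarrow> in_symbol \<Rightarrow> nat list \<Rightarrow>
    (nat \<times> direction \<times> (nat \<times> direction) list \<times> bool option) option" where
  "compile_instr Stop pc ph s ws = None"
| "compile_instr (Io h) pc ph s ws =
    (case h s of (a, d, ob) \<Rightarrow> Some (st a 0, d, idle ws, ob))"
| "compile_instr (Inc t a) pc ph s ws = Some
    (if ph = 0 then (st pc 1, Stay, act ws t 3 Go_Right, None)
     else if ph = 1 then
       if ws ! t = digit True then (st pc 1, Stay, act ws t (digit False) Go_Right, None)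
       else (st pc 2, Stay, act ws t (digit True) Go_Left, None)
     else if ws ! t = 3 then (st a 0, Stay, idle ws, None)
     else (st pc 2, Stay, act ws t (ws ! t) Go_Left, None))"
| "compile_instr (Dec t a b) pc ph s ws = Some
    (if ph = 0 then (st pc 1, Stay, act ws t 3 Go_Right, None)
     else if ph = 1 then
       if ws ! t = digit False then (st pc 1, Stay, act ws t (digit True) Go_Right, None)
       else if ws ! t = digit True then (st pc 2, Stay, act ws t (digit False) Go_Left, None)
       else (st pc 3, Stay, act ws t 0 Go_Left, None)
     else if ph = 2 then
       if ws ! t = 3 then (st a 0, Stay, idle ws, None)
       else (st pc 2, Stay, act ws t (ws ! t) Go_Left, None)
     else if ws ! t = 3 then (st b 0, Stay, idle ws, None)
     else (st pc 3, Stay, act ws t (digit False) Go_Left, None))"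

definition compile :: "instr list \<Rightarrow> nat \<Rightarrow> tm" where
  "compile code c =
     \<lparr>num_states = st (length code) 0, num_symbols = 4, num_tapes = c,
      trans = \<lambda>q s ws. if q = 0 then Some (st 0 0, Stay, replicate c (3, Stay), None)
        else compile_instr (code ! ((q - 1) div 4)) ((q - 1) div 4) ((q - 1) mod 4) s ws\<rparr>"

lemma trans_compile:
  "ph < 4 \<Longrightarrow> trans (compile code c) (st pc ph) s ws = compile_instr (code ! pc) pc ph s ws"
  by (simp add: compile_def st_def)

lemma is_tm_compile:
  assumes "code \<noteq> []" "\<And>i. i \<in> set code \<Longrightarrow> valid_instr (length code) c i"
  shows "is_tm (compile code c)"
proof -
  have length: "length (idle ws) = length ws" "length (act ws t s d) = length ws" for ws t s d
    by (auto simp: idle_def act_def)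
  have symbols: "(s', d') \<in> set (idle ws) \<Longrightarrow> set ws \<subseteq> {..<4} \<Longrightarrow> s' < 4"
    "(s', d') \<in> set (act ws t s d) \<Longrightarrow> set ws \<subseteq> {..<4} \<Longrightarrow> s < 4 \<Longrightarrow> s' < 4" for ws t s d s' d'
    using set_update_subset_insert[of "idle ws" t "(s, d)"] by (auto simp: act_def idle_def)
  have digit: "digit b < 4" for b by (simp add: digit_def)
  show ?thesis
    unfolding is_tm_def
  proof (intro conjI allI impI)
    fix q s ws q' d acts ob
    assume *: "q < num_states (compile code c) \<and> length ws = num_tapes (compile code c) \<and>
      set ws \<subseteq> {..<num_symbols (compile code c)} \<and> trans (compile code c) q s ws = Some (q', d, acts, ob)"
    have "q' < num_states (compile code c) \<and> length acts = num_tapes (compile code c) \<and>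
      fst ` set acts \<subseteq> {..<num_symbols (compile code c)}"
    proof (cases "q = 0")
      case True
      with * assms(1) show ?thesis by (auto simp: compile_def st_def)
    next
      case False
      define pc where "pc = (q - 1) div 4"
      define ph where "ph = (q - 1) mod 4"
      have pc: "pc < length code" "ph < 4" and ws: "length ws = c" "set ws \<subseteq> {..<4}"
        using * False by (auto simp: compile_def st_def pc_def ph_def)
      have tr: "compile_instr (code ! pc) pc ph s ws = Some (q', d, acts, ob)"
        using * False by (simp add: compile_def pc_def ph_def)
      have valid: "valid_instr (length code) c (code ! pc)"
        using assms(2) pc by simp
      have target: "st a i < st (length code) 0" if "a < length code" "i < 4" for a i
        using that by (simp add: st_def)
      have wt: "ws ! t < 4" if "t < c" for t
        using ws that nth_mem by blast
      have "q' < st (length code) 0 \<and> length acts = c \<and> fst ` set acts \<subseteq> {..<4}"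
      proof (cases "code ! pc")
        case (Inc t a)
        with tr valid pc ws show ?thesis
          by (auto split: if_splits simp: length target wt digit dest!: symbols)
      next
        case (Dec t a b)
        with tr valid pc ws show ?thesis
          by (auto split: if_splits simp: length target wt digit dest!: symbols)
      next
        case (Io h)
        with tr valid pc ws show ?thesis
          by (auto split: prod.splits simp: length target dest!: symbols dest: spec[of _ s])
      next
        case Stop
        with tr show ?thesis by simp
      qed
      then show ?thesis by (simp add: compile_def)
    qed
    then show "q' < num_states (compile code c)" "length acts = num_tapes (compile code c)"
      "fst ` set acts \<subseteq> {..<num_symbols (compile code c)}" by blast+
  qed (auto simp: compile_def st_def)
qed

section \<open>Machine runs within a space bound\<close>

definition space_ok :: "nat \<Rightarrow> config \<Rightarrow> bool" where
  "space_ok s c \<longleftrightarrow> (\<forall>(h, tape)\<in>set (work c). h < s)"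

text \<open>The space is checked at the source of each step, so that runs compose; the last
  configuration is checked separately.\<close>

definition texec :: "tm \<Rightarrow> in_symbol list \<Rightarrow> nat \<Rightarrow> config \<Rightarrow> config \<Rightarrow> bool" where
  "texec M w s = (\<lambda>c c'. tm_step M w c = Some c' \<and> space_ok s c)\<^sup>*\<^sup>*"

lemma texec_refl: "texec M w s c c"
  by (simp add: texec_def)

lemma texec_trans: "texec M w s c c' \<Longrightarrow> texec M w s c' c'' \<Longrightarrow> texec M w s c c''"
  unfolding texec_def by (rule rtranclp_trans)

lemma texec_step:
  "tm_step M w c = Some c' \<Longrightarrow> space_ok s c \<Longrightarrow> texec M w s c' c'' \<Longrightarrow> texec M w s c c''"
  unfolding texec_def by (rule converse_rtranclp_into_rtranclp) auto

text \<open>The machine is deterministic and \<open>c\<close> is halting, so every reachable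
  configuration lies on the given run to \<open>c\<close>. The space bound along this single run
  therefore covers all of them.\<close>

lemma texec_computes:
  assumes run: "texec M w s (init_config M) c" and halt: "tm_step M w c = None" and ok: "space_ok s c"
    and s: "real s \<le> r"
  shows "computes_in_space M w (written c) r"
proof -
  let ?R = "\<lambda>c c'. tm_step M w c = Some c'"
  have "?R\<^sup>*\<^sup>* c0 c' \<Longrightarrow> texec M w s c0 c \<Longrightarrow> texec M w s c' c" for c0 c'
  proof (induction rule: rtranclp_induct)
    case (step c1 c2)
    then have "texec M w s c1 c" by blast
    then show ?case
      using step(2) halt unfolding texec_def by (auto elim: converse_rtranclpE)
  qed
  then have "texec M w s c' c" if "tm_reachable M w c'" for c'
    using that run by (simp add: tm_reachable_def)
  then have "space_ok s c'" if "tm_reachable M w c'" for c'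
    using that ok unfolding texec_def by (auto elim: converse_rtranclpE)
  moreover have "?R\<^sup>*\<^sup>* (init_config M) c"
    using run unfolding texec_def by (rule rtranclp_mono[THEN predicate2D, rotated]) auto
  ultimately show ?thesis
    using halt s unfolding computes_in_space_def tm_reachable_def space_ok_def by fastforce
qed


lemma tm_step_idle:
  assumes "trans M (state c) (scanned w (in_pos c)) (map (\<lambda>(h, tape). tape h) (work c)) =
    Some (q, d, idle (map (\<lambda>(h, tape). tape h) (work c)), ob)"
  shows "tm_step M w c = Some \<lparr>state = q, in_pos = min (move d (in_pos c)) (length w + 1),
    work = work c, written = written c @ (case ob of None \<Rightarrow> [] | Some b \<Rightarrow> [b])\<rparr>"
proof -
  have "map2 (\<lambda>(s, e) (h, tape). (move e h, tape(h := s))) (idle (map (\<lambda>(h, tape). tape h) wk)) wk = wk"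
    for wk :: "(nat \<times> (nat \<Rightarrow> nat)) list"
    by (rule nth_equalityI) (auto simp: idle_def split: prod.splits)
  with assms show ?thesis by (simp add: tm_step_def)
qed

text \<open>The situation while a counter instruction is executed: the input head, the output and
  all work tapes except tape \<open>t\<close> are frozen, with the resting heads on the
  marker.\<close>

locale focused_tape =
  fixes code :: "instr list" and w :: "in_symbol list" and B p :: nat
    and wk :: "(nat \<times> (nat \<Rightarrow> nat)) list" and out :: "bool list" and t :: nat
  assumes t: "t < length wk" and p: "p \<le> length w + 1" and heads: "\<And>u. u < length wk \<Longrightarrow> fst (wk ! u) = 0"
begin

definition focus :: "nat \<Rightarrow> nat \<Rightarrow> (nat \<Rightarrow> nat) \<Rightarrow> config" where
  "focus q h tape = \<lparr>state = q, in_pos = p, work = wk[t := (h, tape)], written = out\<rparr>"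

text \<open>Besides at most \<open>B\<close> digits the head visits the marker and the blank behind
  the last digit, which makes \<open>B + 2\<close> cells.\<close>

abbreviation exec :: "config \<Rightarrow> config \<Rightarrow> bool" where
  "exec \<equiv> texec (compile code (length wk)) w (B + 2)"

lemma space_ok_focus: "h \<le> Suc B \<Longrightarrow> space_ok (B + 2) (focus q h tape)"
proof -
  assume "h \<le> Suc B"
  then have "fst ((wk[t := (h, tape)]) ! u) < B + 2" if "u < length wk" for u
    using that heads[of u] by (cases "u = t") auto
  then show ?thesis
    by (fastforce simp: space_ok_def focus_def in_set_conv_nth)
qed

lemma exec_idle:
  assumes "ph < 4" "h \<le> Suc B"
    and "\<And>ws. length ws = length wk \<Longrightarrow> ws ! t = tape h \<Longrightarrow>
      compile_instr (code ! pc) pc ph (scanned w p) ws = Some (q', Stay, idle ws, None)"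
    and "exec (focus q' h tape) c"
  shows "exec (focus (st pc ph) h tape) c"
proof (rule texec_step[OF _ space_ok_focus assms(4)])
  show "tm_step (compile code (length wk)) w (focus (st pc ph) h tape) = Some (focus q' h tape)"
    using tm_step_idle[of "compile code (length wk)" "focus (st pc ph) h tape" w q' Stay None] p t assms(1)
    by (simp add: focus_def trans_compile assms(3))
qed fact

lemma exec_act:
  assumes "ph < 4" "h \<le> Suc B"
    and "\<And>ws. length ws = length wk \<Longrightarrow> ws ! t = tape h \<Longrightarrow>
      compile_instr (code ! pc) pc ph (scanned w p) ws = Some (q', Stay, act ws t s d, None)"
    and "exec (focus q' (move d h) (tape(h := s))) c"
  shows "exec (focus (st pc ph) h tape) c"
proof (rule texec_step[OF _ space_ok_focus assms(4)])
  define ws where "ws = map (\<lambda>(h, tape). tape h) (wk[t := (h, tape)])"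
  have "map2 (\<lambda>(s, e) (h, tape). (move e h, tape(h := s))) (act ws t s d) (wk[t := (h, tape)]) =
      wk[t := (move d h, tape(h := s))]"
  proof (rule nth_equalityI)
    fix i assume "i < length (map2 (\<lambda>(s, e) (h, tape). (move e h, tape(h := s))) (act ws t s d) (wk[t := (h, tape)]))"
    then have "i < length wk" by simp
    then show "map2 (\<lambda>(s, e) (h, tape). (move e h, tape(h := s))) (act ws t s d) (wk[t := (h, tape)]) ! i =
      wk[t := (move d h, tape(h := s))] ! i"
      using t by (cases "i = t") (auto simp: act_def idle_def ws_def split: prod.splits)
  qed (simp add: act_def idle_def ws_def)
  moreover have "compile_instr (code ! pc) pc ph (scanned w p) ws = Some (q', Stay, act ws t s d, None)"
    by (rule assms(3)) (use t in \<open>simp_all add: ws_def\<close>)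
  ultimately show "tm_step (compile code (length wk)) w (focus (st pc ph) h tape) =
      Some (focus q' (move d h) (tape(h := s)))"
    using p assms(1) by (simp add: tm_step_def focus_def trans_compile ws_def)
qed fact

lemma ctape_marker: "(ctape ds)(0 := 3) = ctape ds"
  by (rule fun_upd_idem) simp

text \<open>The digits in \<open>pre\<close> have been passed already. Where the carry ends is left
  open, because the return works from any cell of the number.\<close>

lemma exec_inc_carry:
  assumes pc: "code ! pc = Inc t a" and len: "length pre + length ds \<le> B"
  shows "\<exists>h\<le>length pre + length ds. exec (focus (st pc 1) (Suc (length pre)) (ctape (pre @ ds)))
    (focus (st pc 2) h (ctape (pre @ inc ds)))"
  using len
proof (induction ds arbitrary: pre rule: inc.induct)
  case 1
  show ?case
    by (intro exI[of _ "length pre"] conjI, simp,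
        rule exec_act[where s = "digit True" and d = Go_Left and q' = "st pc 2"])
      (use 1 pc in \<open>simp_all add: texec_refl\<close>)
next
  case (2 ds)
  show ?case
    by (intro exI[of _ "length pre"] conjI, simp,
        rule exec_act[where s = "digit True" and d = Go_Left and q' = "st pc 2"])
      (use 2 pc in \<open>simp_all add: texec_refl\<close>)
next
  case (3 ds)
  then obtain h where h: "h \<le> length (pre @ [False]) + length ds"
    "exec (focus (st pc 1) (Suc (length (pre @ [False]))) (ctape ((pre @ [False]) @ ds)))
      (focus (st pc 2) h (ctape ((pre @ [False]) @ inc ds)))"
    using "3.IH"[of "pre @ [False]"] by auto
  have "exec (focus (st pc 1) (Suc (length pre)) (ctape (pre @ True # ds)))
      (focus (st pc 2) h (ctape (pre @ inc (True # ds))))"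
    by (rule exec_act[where s = "digit False" and d = Go_Right and q' = "st pc 1"])
      (use 3 h pc in simp_all)
  with h(1) show ?case by auto
qed

text \<open>Stated for any instruction with this behaviour in phase 2, so that \<open>Inc\<close>
  and a successful \<open>Dec\<close> share it.\<close>

lemma exec_return:
  assumes pc: "\<And>s ws. compile_instr (code ! pc) pc 2 s ws =
      Some (if ws ! t = 3 then (st a 0, Stay, idle ws, None) else (st pc 2, Stay, act ws t (ws ! t) Go_Left, None))"
    and "h \<le> length us" "length us \<le> Suc B"
  shows "exec (focus (st pc 2) h (ctape us)) (focus (st a 0) 0 (ctape us))"
  using assms(2)
proof (induction h)
  case 0
  show ?case by (rule exec_idle[where q' = "st a 0"]) (simp_all add: pc texec_refl)
next
  case (Suc h)
  have "ctape us (Suc h) \<noteq> 3" using Suc by (simp add: ctape_def)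
  with Suc assms(3) show ?case
    by - (rule exec_act[where s = "ctape us (Suc h)" and d = Go_Left and q' = "st pc 2"],
       simp_all add: pc)
qed

lemma exec_Inc:
  assumes pc: "code ! pc = Inc t a" and "length ds \<le> B"
  shows "exec (focus (st pc 0) 0 (ctape ds)) (focus (st a 0) 0 (ctape (inc ds)))"
proof -
  have inc_len: "length ds \<le> length (inc ds) \<and> length (inc ds) \<le> Suc (length ds)"
    by (induction ds rule: inc.induct) auto
  obtain h where h: "h \<le> length ds" "exec (focus (st pc 1) 1 (ctape ds)) (focus (st pc 2) h (ctape (inc ds)))"
    using exec_inc_carry[OF pc, of "[]" ds] assms(2) by auto
  have "exec (focus (st pc 2) h (ctape (inc ds))) (focus (st a 0) 0 (ctape (inc ds)))"
    by (rule exec_return) (use h inc_len assms in auto)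
  from texec_trans[OF h(2) this] show ?thesis
    by - (rule exec_act[where s = 3 and d = Go_Right and q' = "st pc 1"],
       simp_all add: pc ctape_marker)
qed

lemma exec_dec_borrow_Some:
  assumes pc: "code ! pc = Dec t a b" and "length pre + length ds \<le> B" "dec ds = Some ds'"
  shows "\<exists>h\<le>length pre + length ds. exec (focus (st pc 1) (Suc (length pre)) (ctape (pre @ ds)))
    (focus (st pc 2) h (ctape (pre @ ds')))"
  using assms(2,3)
proof (induction ds arbitrary: pre ds' rule: dec.induct)
  case (2 ds)
  show ?case
    by (intro exI[of _ "length pre"] conjI, simp,
        rule exec_act[where s = "digit False" and d = Go_Left and q' = "st pc 2"])
      (use 2 pc in \<open>auto simp: texec_refl\<close>)
next
  case (3 ds)
  then obtain es where es: "dec ds = Some es" "ds' = True # es" by auto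
  with 3 obtain h where h: "h \<le> length (pre @ [True]) + length ds"
    "exec (focus (st pc 1) (Suc (length (pre @ [True]))) (ctape ((pre @ [True]) @ ds)))
      (focus (st pc 2) h (ctape ((pre @ [True]) @ es)))"
    using "3.IH"[of "pre @ [True]" es] by auto
  have "exec (focus (st pc 1) (Suc (length pre)) (ctape (pre @ False # ds)))
      (focus (st pc 2) h (ctape (pre @ ds')))"
    by (rule exec_act[where s = "digit True" and d = Go_Right and q' = "st pc 1"])
      (use 3 h es pc in simp_all)
  with h(1) show ?case by auto
qed simp

text \<open>A zero of any length is recognized only at the blank behind it, when the borrow has
  already turned all its digits into ones.\<close>

lemma exec_dec_borrow_None:
  assumes pc: "code ! pc = Dec t a b"
  shows "length pre + n \<le> B \<Longrightarrow>
    exec (focus (st pc 1) (Suc (length pre)) (ctape (pre @ replicate n False)))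
    (focus (st pc 3) (length pre + n) (ctape (pre @ replicate n True)))"
proof (induction n arbitrary: pre)
  case 0
  have "(ctape pre)(Suc (length pre) := 0) = ctape pre" by (rule fun_upd_idem) simp
  with 0 show ?case
    by - (rule exec_act[where s = 0 and d = Go_Left and q' = "st pc 3"], simp_all add: pc texec_refl)
next
  case (Suc n)
  have "exec (focus (st pc 1) (Suc (length (pre @ [True]))) (ctape ((pre @ [True]) @ replicate n False)))
    (focus (st pc 3) (length (pre @ [True]) + n) (ctape ((pre @ [True]) @ replicate n True)))"
    by (rule Suc.IH) (use Suc in simp)
  with Suc.prems show ?case
    by - (rule exec_act[where s = "digit True" and d = Go_Right and q' = "st pc 1"],
       simp_all add: pc)
qed

text \<open>Here \<open>us\<close> is the part not yet restored. It is arbitrary because phase 3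
  writes a zero over whichever digit it meets.\<close>

lemma exec_dec_restore:
  assumes pc: "code ! pc = Dec t a b"
  shows "length us + n \<le> B \<Longrightarrow> exec (focus (st pc 3) (length us) (ctape (us @ replicate n False)))
    (focus (st b 0) 0 (ctape (replicate (length us + n) False)))"
proof (induction us arbitrary: n rule: rev_induct)
  case Nil
  show ?case by (rule exec_idle[where q' = "st b 0"]) (simp_all add: pc texec_refl)
next
  case (snoc u us)
  have "exec (focus (st pc 3) (length us) (ctape (us @ replicate (Suc n) False)))
    (focus (st b 0) 0 (ctape (replicate (length us + Suc n) False)))"
    by (rule snoc.IH) (use snoc in simp)
  with snoc.prems show ?case
    by - (rule exec_act[where s = "digit False" and d = Go_Left and q' = "st pc 3"],
       simp_all add: pc)
qed

lemma exec_Dec: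
  assumes pc: "code ! pc = Dec t a b" and len: "length ds \<le> B"
  shows "exec (focus (st pc 0) 0 (ctape ds))
    (case dec ds of None \<Rightarrow> focus (st b 0) 0 (ctape ds) | Some ds' \<Rightarrow> focus (st a 0) 0 (ctape ds'))"
proof -
  have "exec (focus (st pc 1) 1 (ctape ds))
    (case dec ds of None \<Rightarrow> focus (st b 0) 0 (ctape ds) | Some ds' \<Rightarrow> focus (st a 0) 0 (ctape ds'))"
  proof (cases "dec ds")
    case None
    obtain n where ds: "ds = replicate n False" using dec_None[OF None] by blast
    have "exec (focus (st pc 1) 1 (ctape ds)) (focus (st pc 3) n (ctape (replicate n True)))"
      using exec_dec_borrow_None[OF pc, of "[]" n] len by (simp add: ds)
    moreover have "exec (focus (st pc 3) n (ctape (replicate n True))) (focus (st b 0) 0 (ctape ds))"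
      using exec_dec_restore[OF pc, of "replicate n True" 0] len by (simp add: ds)
    ultimately show ?thesis using None texec_trans by simp
  next
    case (Some ds')
    obtain h where h: "h \<le> length ds" "exec (focus (st pc 1) 1 (ctape ds)) (focus (st pc 2) h (ctape ds'))"
      using exec_dec_borrow_Some[OF pc, of "[]" ds ds'] len Some by auto
    have "exec (focus (st pc 2) h (ctape ds')) (focus (st a 0) 0 (ctape ds'))"
      by (rule exec_return) (use h dec_Some[OF Some] len pc in auto)
    with h(2) Some show ?thesis using texec_trans by simp
  qed
  then show ?thesis
    by - (rule exec_act[where s = 3 and d = Go_Right and q' = "st pc 1"],
       simp_all add: pc ctape_marker)
qed

end

section \<open>Counter configurations as machine configurations\<close>

text \<open>The invariant between two instructions. The digits are existentially quantified, since
  leading zeros give a counter value several representations.\<close>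

fun represents :: "nat \<Rightarrow> nat \<Rightarrow> in_symbol list \<Rightarrow> cconfig \<Rightarrow> config \<Rightarrow> bool" where
  "represents c B w (pc, p, vs, out) C \<longleftrightarrow>
     state C = st pc 0 \<and> in_pos C = p \<and> p \<le> length w + 1 \<and> written C = out \<and>
     length vs = c \<and> length (work C) = c \<and>
     (\<forall>t<c. \<exists>ds. work C ! t = (0, ctape ds) \<and> length ds \<le> B \<and> val ds = vs ! t)"

lemma represents_space_ok: "represents c B w C D \<Longrightarrow> space_ok (B + 2) D"
  by (cases C) (fastforce simp: space_ok_def in_set_conv_nth)

text \<open>A counter instruction acts on the tape of its counter alone, and the overflow check of
  \<open>cnext\<close> is what keeps the digits within \<open>B\<close> cells.\<close>

lemma compile_step:
  assumes step: "cnext code w B C = Some C'" and rep: "represents c B w C D"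
    and valid: "valid_instr N c (code ! fst C)"
  shows "\<exists>D'. texec (compile code c) w (B + 2) D D' \<and> represents c B w C' D'"
proof -
  obtain pc p vs out where C: "C = (pc, p, vs, out)" by (cases C)
  note rep' = rep[unfolded C represents.simps]
  have len: "length (work D) = c" using rep' by blast
  have foc: "focused_tape w p (work D) t" if "t < c" for t
    using rep' that by unfold_locales auto
  have tape: "\<exists>ds. D = focused_tape.focus p (work D) out t (st pc 0) 0 (ctape ds) \<and>
      length ds \<le> B \<and> val ds = vs ! t" if tc: "t < c" for t
  proof -
    obtain ds where ds: "work D ! t = (0, ctape ds)" "length ds \<le> B" "val ds = vs ! t"
      using rep' tc by blast
    then have "(work D)[t := (0, ctape ds)] = work D"
      by (metis list_update_id)
    then have "D = focused_tape.focus p (work D) out t (st pc 0) 0 (ctape ds)"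
      using rep' by (simp add: focused_tape.focus_def[OF foc[OF tc]])
    with ds show ?thesis by blast
  qed
  have result: "represents c B w (a, p, vs[t := v], out)
      (focused_tape.focus p (work D) out t (st a 0) 0 (ctape ds))"
    if "t < c" "length ds \<le> B" "val ds = v" for a t v ds
    using rep' that by (auto simp: focused_tape.focus_def[OF foc[OF that(1)]] nth_list_update)
  show ?thesis
  proof (cases "code ! pc")
    case (Inc t a)
    then have tc: "t < c" using valid by (simp add: C)
    interpret focused_tape code w B p "work D" out t by (rule foc[OF tc])
    obtain ds where ds: "focus (st pc 0) 0 (ctape ds) = D" "length ds \<le> B" "val ds = vs ! t"
      using tape[OF tc] by metis
    have C': "C' = (a, p, vs[t := Suc (vs ! t)], out)" "Suc (vs ! t) < 2 ^ B"
      using step Inc by (auto simp: C split: if_splits)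
    have "exec D (focus (st a 0) 0 (ctape (inc ds)))"
      using exec_Inc[OF Inc ds(2)] unfolding ds(1) .
    moreover have "represents c B w C' (focus (st a 0) 0 (ctape (inc ds)))"
      unfolding C'(1) using ds(2,3) C'(2) by (intro result[OF tc] length_inc) (auto simp: val_inc)
    ultimately show ?thesis unfolding len by blast
  next
    case (Dec t a b)
    then have tc: "t < c" using valid by (simp add: C)
    interpret focused_tape code w B p "work D" out t by (rule foc[OF tc])
    obtain ds where ds: "focus (st pc 0) 0 (ctape ds) = D" "length ds \<le> B" "val ds = vs ! t"
      using tape[OF tc] by metis
    show ?thesis
    proof (cases "dec ds")
      case None
      then have "vs ! t = 0"
        using ds(3) dec_None[OF None] val_zeros by metis
      then have "C' = (b, p, vs, out)" using step Dec by (simp add: C)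
      then have "represents c B w C' (focus (st b 0) 0 (ctape ds))"
        using result[OF tc ds(2,3), of b] by (simp only: list_update_id)
      moreover have "exec D (focus (st b 0) 0 (ctape ds))"
        using exec_Dec[OF Dec ds(2)] unfolding None ds(1) option.case .
      ultimately show ?thesis unfolding len by blast
    next
      case (Some ds')
      note ds' = dec_Some[OF Some]
      have "C' = (a, p, vs[t := vs ! t - 1], out)"
        using step Dec ds' ds(3)[symmetric] by (simp add: C)
      then have "represents c B w C' (focus (st a 0) 0 (ctape ds'))"
        using result[OF tc, of ds' "vs ! t - 1" a] ds(2,3) ds' by simp
      moreover have "exec D (focus (st a 0) 0 (ctape ds'))"
        using exec_Dec[OF Dec ds(2)] unfolding Some ds(1) option.case .
      ultimately show ?thesis unfolding len by blast
    qed
  next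
    case (Io h)
    obtain a d ob where h: "h (scanned w p) = (a, d, ob)" by (cases "h (scanned w p)")
    define D' where "D' = \<lparr>state = st a 0, in_pos = min (move d p) (length w + 1), work = work D,
      written = out @ (case ob of None \<Rightarrow> [] | Some b \<Rightarrow> [b])\<rparr>"
    have "tm_step (compile code c) w D = Some D'"
      using tm_step_idle[of "compile code c" D w "st a 0" d ob] rep'
      by (simp add: trans_compile Io h D'_def)
    then have "texec (compile code c) w (B + 2) D D'"
      using texec_step[OF _ represents_space_ok[OF rep] texec_refl] by blast
    moreover have "represents c B w C' D'"
      using rep' step Io h by (auto simp: C D'_def)
    ultimately show ?thesis by blast
  next
    case Stop
    with step show ?thesis by (simp add: C)
  qed
qed

lemma cexec_valid_pc:
  assumes "cexec code w B C C'" and valid: "\<And>i. i \<in> set code \<Longrightarrow> valid_instr (length code) c i"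
    and "fst C < length code"
  shows "fst C' < length code"
  using assms(1,3) unfolding cexec_def
proof (induction rule: rtranclp_induct)
  case (step C1 C2)
  then have "valid_instr (length code) c (code ! fst C1)" by (intro valid) auto
  with step(2) show ?case
    by (cases C1; cases "code ! fst C1")
      (auto split: if_splits prod.splits dest!: spec[of _ "scanned w (fst (snd C1))"])
qed

lemma compile_exec:
  assumes "cexec code w B C C'" and valid: "\<And>i. i \<in> set code \<Longrightarrow> valid_instr (length code) c i"
    and pc: "fst C < length code" and rep: "represents c B w C D"
  shows "\<exists>D'. texec (compile code c) w (B + 2) D D' \<and> represents c B w C' D'"
  using assms(1) unfolding cexec_def
proof (induction rule: rtranclp_induct)
  case base
  then show ?case using rep texec_refl by blast
next
  case (step C1 C2)
  then obtain D1 where D1: "texec (compile code c) w (B + 2) D D1" "represents c B w C1 D1" by blast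
  have "fst C1 < length code"
    using cexec_valid_pc[OF _ valid pc] step(1) unfolding cexec_def by blast
  then have "valid_instr (length code) c (code ! fst C1)" by (intro valid) auto
  from compile_step[OF step(2) D1(2) this] D1(1) show ?case using texec_trans by blast
qed

lemma compile_computes:
  assumes code: "code \<noteq> []" "\<And>i. i \<in> set code \<Longrightarrow> valid_instr (length code) c i"
    and run: "cexec code w B (0, 0, replicate c 0, []) (pc, p, vs, out)" "code ! pc = Stop"
    and r: "real (B + 2) \<le> r"
  shows "computes_in_space (compile code c) w out r"
proof -
  let ?M = "compile code c"
  define D where "D = \<lparr>state = st 0 0, in_pos = 0, work = replicate c (0, ctape []), written = []\<rparr>"
  \<comment> \<open>A blank tape with the marker in cell 0 represents the empty digit string, whose
    value is 0.\<close>
  have "(\<lambda>_. 0)(0 := 3) = ctape []" by (rule ext) (simp add: ctape_def)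
  then have "tm_step ?M w (init_config ?M) = Some D"
    by (simp add: tm_step_def init_config_def D_def compile_def map2_map_map zip_replicate map_replicate_const)
  moreover have "space_ok (B + 2) (init_config ?M)"
    by (simp add: space_ok_def init_config_def)
  ultimately have init: "texec ?M w (B + 2) (init_config ?M) D"
    using texec_step texec_refl by blast
  have "represents c B w (0, 0, replicate c 0, []) D"
    by (auto simp: D_def intro!: exI[of _ "[]"])
  then have "\<exists>D'. texec ?M w (B + 2) D D' \<and> represents c B w (pc, p, vs, out) D'"
    using code(1) by (intro compile_exec[OF run(1) code(2)]) simp_all
  then obtain D' where D': "texec ?M w (B + 2) D D'" "represents c B w (pc, p, vs, out) D'"
    by blast
  have "tm_step ?M w D' = None"
    using D'(2) run(2) by (simp add: tm_step_def trans_compile)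
  then have "computes_in_space ?M w (written D') r"
    using texec_computes[OF texec_trans[OF init D'(1)] _ represents_space_ok[OF D'(2)] r] by blast
  then show ?thesis using D'(2) by simp
qed

section \<open>A counter program for the extractor\<close>

lemma clear_loop:
  assumes "code ! pc = Dec a pc r"
  shows "a < length vs \<Longrightarrow> cexec code w B (pc, p, vs, out) (r, p, vs[a := 0], out)"
proof (induction "vs ! a" arbitrary: vs)
  case 0
  then have "vs[a := 0] = vs" by (metis list_update_id)
  with 0 show ?case by (intro cexec_step[OF _ cexec_refl]) (simp add: assms)
next
  case (Suc v)
  have "cexec code w B (pc, p, vs[a := v], out) (r, p, vs[a := v, a := 0], out)"
    by (rule Suc(1)) (use Suc in simp_all)
  with Suc(2)[symmetric] show ?case
    by - (rule cexec_step, simp_all add: assms)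
qed

lemma transfer_loop:
  assumes "code ! pc = Dec a q r" "code ! q = Inc b pc" "a \<noteq> b"
  shows "a < length vs \<Longrightarrow> b < length vs \<Longrightarrow> vs ! a + vs ! b < 2 ^ B \<Longrightarrow>
    cexec code w B (pc, p, vs, out) (r, p, vs[a := 0, b := vs ! a + vs ! b], out)"
proof (induction "vs ! a" arbitrary: vs)
  case 0
  then have "vs[a := 0, b := vs ! a + vs ! b] = vs" by (metis list_update_id add_0)
  with 0 show ?case by (intro cexec_step[OF _ cexec_refl]) (simp add: assms)
next
  case (Suc v)
  let ?vs = "vs[a := v, b := Suc (vs ! b)]"
  have "cexec code w B (pc, p, ?vs, out) (r, p, ?vs[a := 0, b := ?vs ! a + ?vs ! b], out)"
    by (rule Suc(1)) (use Suc assms in simp_all)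
  also have "?vs[a := 0, b := ?vs ! a + ?vs ! b] = vs[a := 0, b := vs ! a + vs ! b]"
    using Suc(2)[symmetric] Suc(3,4) assms(3) by (simp add: list_update_swap)
  finally have "cexec code w B (pc, p, ?vs, out) (r, p, vs[a := 0, b := vs ! a + vs ! b], out)" .
  moreover have "cexec code w B (pc, p, vs, out) (pc, p, ?vs, out)"
    by (rule cexec_step, simp add: assms Suc(2)[symmetric], rule cexec_step,
        use Suc(2)[symmetric] Suc(3-5) assms in simp, simp add: cexec_refl)
  ultimately show ?case using cexec_trans by blast
qed

text \<open>Reading a counter destroys it, so its value goes to two counters at once;
  \<open>transfer_loop\<close> then moves one of the copies back.\<close>

lemma copy_loop:
  assumes "code ! pc = Dec a q r" "code ! q = Inc b q'" "code ! q' = Inc c pc"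
    and "a \<noteq> b" "a \<noteq> c" "b \<noteq> c"
  shows "a < length vs \<Longrightarrow> b < length vs \<Longrightarrow> c < length vs \<Longrightarrow>
    vs ! a + vs ! b < 2 ^ B \<Longrightarrow> vs ! a + vs ! c < 2 ^ B \<Longrightarrow>
    cexec code w B (pc, p, vs, out) (r, p, vs[a := 0, b := vs ! a + vs ! b, c := vs ! a + vs ! c], out)"
proof (induction "vs ! a" arbitrary: vs)
  case 0
  then have "vs[a := 0, b := vs ! a + vs ! b, c := vs ! a + vs ! c] = vs"
    by (metis list_update_id add_0)
  with 0 show ?case by (intro cexec_step[OF _ cexec_refl]) (simp add: assms)
next
  case (Suc v)
  let ?vs = "vs[a := v, b := Suc (vs ! b), c := Suc (vs ! c)]"
  have "cexec code w B (pc, p, ?vs, out)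
      (r, p, ?vs[a := 0, b := ?vs ! a + ?vs ! b, c := ?vs ! a + ?vs ! c], out)"
    by (rule Suc(1)) (use Suc assms in simp_all)
  also have "?vs[a := 0, b := ?vs ! a + ?vs ! b, c := ?vs ! a + ?vs ! c] =
      vs[a := 0, b := vs ! a + vs ! b, c := vs ! a + vs ! c]"
    by (rule nth_equalityI) (use Suc(2)[symmetric] Suc(3-5) assms(4-6) in \<open>auto simp: nth_list_update\<close>)
  finally have "cexec code w B (pc, p, ?vs, out)
      (r, p, vs[a := 0, b := vs ! a + vs ! b, c := vs ! a + vs ! c], out)" .
  moreover have "cexec code w B (pc, p, vs, out) (pc, p, ?vs, out)"
    by (rule cexec_step, simp add: assms Suc(2)[symmetric], rule cexec_step,
        use Suc(2)[symmetric] Suc(3-7) assms in simp, rule cexec_step,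
        use Suc(2)[symmetric] Suc(3-7) assms in simp, simp add: cexec_refl)
  ultimately show ?case using cexec_trans by blast
qed

lemma double_loop:
  assumes "code ! pc = Dec a q r" "code ! q = Inc b q'" "code ! q' = Inc b pc" "a \<noteq> b"
  shows "a < length vs \<Longrightarrow> b < length vs \<Longrightarrow> 2 * vs ! a + vs ! b < 2 ^ B \<Longrightarrow>
    cexec code w B (pc, p, vs, out) (r, p, vs[a := 0, b := 2 * vs ! a + vs ! b], out)"
proof (induction "vs ! a" arbitrary: vs)
  case 0
  then have "vs[a := 0, b := 2 * vs ! a + vs ! b] = vs"
    by (metis list_update_id add_0 mult_0_right)
  with 0 show ?case by (intro cexec_step[OF _ cexec_refl]) (simp add: assms)
next
  case (Suc v)
  let ?vs = "vs[a := v, b := Suc (Suc (vs ! b))]"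
  have "cexec code w B (pc, p, ?vs, out) (r, p, ?vs[a := 0, b := 2 * ?vs ! a + ?vs ! b], out)"
    by (rule Suc(1)) (use Suc assms in simp_all)
  also have "?vs[a := 0, b := 2 * ?vs ! a + ?vs ! b] = vs[a := 0, b := 2 * vs ! a + vs ! b]"
    by (rule nth_equalityI) (use Suc(2)[symmetric] Suc(3,4) assms(4) in \<open>auto simp: nth_list_update\<close>)
  finally have "cexec code w B (pc, p, ?vs, out) (r, p, vs[a := 0, b := 2 * vs ! a + vs ! b], out)" .
  moreover have "cexec code w B (pc, p, vs, out) (pc, p, ?vs, out)"
    by (rule cexec_step, simp add: assms Suc(2)[symmetric], rule cexec_step,
        use Suc(2)[symmetric] Suc(3-5) assms in simp, rule cexec_step,
        use Suc(2)[symmetric] Suc(3-5) assms in simp, simp add: cexec_refl)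
  ultimately show ?case using cexec_trans by blast
qed

text \<open>The distance is saved in counter \<open>b\<close> during the walk, so that the position
  can be restored afterwards.\<close>

lemma walk_right_loop:
  assumes "code ! pc = Dec a q r" "code ! q = Inc b q'" "code ! q' = Io (\<lambda>_. (pc, Go_Right, None))" "a \<noteq> b"
  shows "a < length vs \<Longrightarrow> b < length vs \<Longrightarrow> vs ! a + vs ! b < 2 ^ B \<Longrightarrow> p + vs ! a \<le> length w \<Longrightarrow>
    cexec code w B (pc, p, vs, out) (r, p + vs ! a, vs[a := 0, b := vs ! a + vs ! b], out)"
proof (induction "vs ! a" arbitrary: vs p)
  case 0
  then have "vs[a := 0, b := vs ! a + vs ! b] = vs" by (metis list_update_id add_0)
  with 0 show ?case by (intro cexec_step[OF _ cexec_refl]) (simp add: assms)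
next
  case (Suc v)
  let ?vs = "vs[a := v, b := Suc (vs ! b)]"
  have "cexec code w B (pc, Suc p, ?vs, out)
      (r, Suc p + ?vs ! a, ?vs[a := 0, b := ?vs ! a + ?vs ! b], out)"
    by (rule Suc(1)) (use Suc assms in simp_all)
  also have "?vs[a := 0, b := ?vs ! a + ?vs ! b] = vs[a := 0, b := vs ! a + vs ! b]"
    by (rule nth_equalityI) (use Suc(2)[symmetric] Suc(3,4) assms(4) in \<open>auto simp: nth_list_update\<close>)
  also have "Suc p + ?vs ! a = p + vs ! a"
    using Suc(2)[symmetric] Suc(3,4) assms(4) by simp
  finally have "cexec code w B (pc, Suc p, ?vs, out)
      (r, p + vs ! a, vs[a := 0, b := vs ! a + vs ! b], out)" .
  moreover have "cexec code w B (pc, p, vs, out) (pc, Suc p, ?vs, out)"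
    by (rule cexec_step, simp add: assms Suc(2)[symmetric], rule cexec_step,
        use Suc(2)[symmetric] Suc(3-5) assms in simp, rule cexec_step,
        use Suc(2)[symmetric] Suc(6) assms in simp, simp add: cexec_refl)
  ultimately show ?case using cexec_trans by blast
qed

lemma walk_left_loop:
  assumes "code ! pc = Dec a q r" "code ! q = Inc b q'" "code ! q' = Io (\<lambda>_. (pc, Go_Left, None))" "a \<noteq> b"
  shows "a < length vs \<Longrightarrow> b < length vs \<Longrightarrow> vs ! a + vs ! b < 2 ^ B \<Longrightarrow> p \<le> length w \<Longrightarrow>
    cexec code w B (pc, p, vs, out) (r, p - vs ! a, vs[a := 0, b := vs ! a + vs ! b], out)"
proof (induction "vs ! a" arbitrary: vs p)
  case 0
  then have "vs[a := 0, b := vs ! a + vs ! b] = vs" by (metis list_update_id add_0)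
  with 0 show ?case by (intro cexec_step[OF _ cexec_refl]) (simp add: assms)
next
  case (Suc v)
  let ?vs = "vs[a := v, b := Suc (vs ! b)]"
  have "cexec code w B (pc, p - 1, ?vs, out)
      (r, p - 1 - ?vs ! a, ?vs[a := 0, b := ?vs ! a + ?vs ! b], out)"
    by (rule Suc(1)) (use Suc assms in simp_all)
  also have "?vs[a := 0, b := ?vs ! a + ?vs ! b] = vs[a := 0, b := vs ! a + vs ! b]"
    by (rule nth_equalityI) (use Suc(2)[symmetric] Suc(3,4) assms(4) in \<open>auto simp: nth_list_update\<close>)
  also have "p - 1 - ?vs ! a = p - vs ! a"
    using Suc(2)[symmetric] Suc(3,4) assms(4) by simp
  finally have "cexec code w B (pc, p - 1, ?vs, out)
      (r, p - vs ! a, vs[a := 0, b := vs ! a + vs ! b], out)" .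
  moreover have "cexec code w B (pc, p, vs, out) (pc, p - 1, ?vs, out)"
    by (rule cexec_step, simp add: assms Suc(2)[symmetric], rule cexec_step,
        use Suc(2)[symmetric] Suc(3-5) assms in simp, rule cexec_step,
        use Suc(2)[symmetric] Suc(6) assms in simp, simp add: cexec_refl)
  ultimately show ?case using cexec_trans by blast
qed

definition rewind :: "nat \<Rightarrow> nat \<Rightarrow> instr" where
  "rewind pc r = Io (\<lambda>s. if s = Left_End then (r, Go_Right, None) else (pc, Go_Left, None))"

definition goto :: "nat \<Rightarrow> direction \<Rightarrow> bool option \<Rightarrow> instr" where
  "goto r d ob = Io (\<lambda>_. (r, d, ob))"

definition if_bit :: "nat \<Rightarrow> direction \<Rightarrow> nat \<Rightarrow> instr" where
  "if_bit q d r = Io (\<lambda>s. case s of Bit _ \<Rightarrow> (q, d, None) | _ \<Rightarrow> (r, Stay, None))"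

definition if_one :: "nat \<Rightarrow> nat \<Rightarrow> direction \<Rightarrow> instr" where
  "if_one q r d = Io (\<lambda>s. if s = Bit True then (q, d, None) else (r, d, None))"

definition find_sep :: "nat \<Rightarrow> nat \<Rightarrow> direction \<Rightarrow> instr" where
  "find_sep pc r d = Io (\<lambda>s. if s = Separator then (r, d, None) else (pc, Go_Right, None))"

lemmas io_defs = rewind_def goto_def if_bit_def if_one_def find_sep_def

lemma rewind_loop:
  assumes "code ! pc = rewind pc r" "w \<noteq> []" "\<And>s. s \<in> set w \<Longrightarrow> s \<noteq> Left_End"
  shows "p \<le> length w + 1 \<Longrightarrow> cexec code w B (pc, p, vs, out) (r, 1, vs, out)"
proof (induction p)
  case 0
  show ?case
    by (rule cexec_step[OF _ cexec_refl]) (simp add: assms(1) io_defs scanned_def)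
next
  case (Suc p)
  then have "scanned w (Suc p) \<noteq> Left_End"
    using assms(3)[of "w ! p"] by (auto simp: scanned_def)
  with Suc show ?case
    by - (rule cexec_step, simp_all add: assms(1) io_defs)
qed

lemma find_sep_loop:
  assumes code: "code ! pc = find_sep pc r d" and s: "scanned w s = Separator" "s \<le> length w"
    and before: "\<And>q. q < s \<Longrightarrow> scanned w q \<noteq> Separator"
  shows "p \<le> s \<Longrightarrow> cexec code w B (pc, p, vs, out) (r, min (move d s) (length w + 1), vs, out)"
proof (induction p rule: inc_induct)
  case base
  show ?case
    by (rule cexec_step[OF _ cexec_refl]) (simp add: code io_defs s)
next
  case (step p)
  with before[of p] s(2) show ?case
    by - (rule cexec_step, simp_all add: code io_defs)
qed

text \<open>
  Counters: 0 outputs left, 1 countdown, 2 scratch, 3 block length, 4 position in \<open>x\<close>, 5 parity.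
  Lines 0--8 read \<open>m\<close> by Horner's rule, 9--13 copy it, 15--24 divide the length of \<open>x\<close> by \<open>3 * m\<close>,
  and 25--49 output the inner products.
\<close>
definition prog :: "instr list" where
  "prog =
    [find_sep 0 1 Go_Right,
     if_bit 2 Stay 9, Dec 0 3 5, Inc 2 4, Inc 2 2, Dec 2 6 7, Inc 0 5, if_one 8 1 Go_Right, Inc 0 1,
     Dec 0 10 12, Inc 1 11, Inc 2 9, Dec 2 13 14, Inc 0 12,
     rewind 14 15,
     Dec 1 16 20, if_bit 17 Go_Right 23, if_bit 18 Go_Right 23, if_bit 19 Go_Right 23, Inc 2 15,
     Inc 3 21, Dec 2 22 15, Inc 1 21,
     Dec 2 23 24, Dec 1 24 25,
     Dec 0 26 50,
     Dec 3 27 29, Inc 1 28, Inc 2 26, Dec 2 30 31, Inc 3 29,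
     Dec 1 32 46,
     rewind 32 33, Dec 4 34 36, Inc 2 35, goto 33 Go_Right None, if_one 37 42 Stay,
     find_sep 37 38 Go_Left, Dec 2 39 41, Inc 4 40, goto 38 Go_Left None, if_one 44 42 Stay,
     Dec 2 43 47, Inc 4 42,
     Dec 5 42 45, Inc 5 42,
     Dec 5 48 49,
     Inc 4 31,
     goto 25 Stay (Some True), goto 25 Stay (Some False),
     Stop]"

lemma prog_nth:
  "prog ! 0 = find_sep 0 1 Go_Right" "prog ! 1 = if_bit 2 Stay 9" "prog ! 2 = Dec 0 3 5"
  "prog ! 3 = Inc 2 4" "prog ! 4 = Inc 2 2" "prog ! 5 = Dec 2 6 7" "prog ! 6 = Inc 0 5"
  "prog ! 7 = if_one 8 1 Go_Right" "prog ! 8 = Inc 0 1" "prog ! 9 = Dec 0 10 12"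
  "prog ! 10 = Inc 1 11" "prog ! 11 = Inc 2 9" "prog ! 12 = Dec 2 13 14" "prog ! 13 = Inc 0 12"
  "prog ! 14 = rewind 14 15" "prog ! 15 = Dec 1 16 20" "prog ! 16 = if_bit 17 Go_Right 23"
  "prog ! 17 = if_bit 18 Go_Right 23" "prog ! 18 = if_bit 19 Go_Right 23" "prog ! 19 = Inc 2 15"
  "prog ! 20 = Inc 3 21" "prog ! 21 = Dec 2 22 15" "prog ! 22 = Inc 1 21" "prog ! 23 = Dec 2 23 24"
  "prog ! 24 = Dec 1 24 25" "prog ! 25 = Dec 0 26 50" "prog ! 26 = Dec 3 27 29"
  "prog ! 27 = Inc 1 28" "prog ! 28 = Inc 2 26" "prog ! 29 = Dec 2 30 31" "prog ! 30 = Inc 3 29"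
  "prog ! 31 = Dec 1 32 46" "prog ! 32 = rewind 32 33" "prog ! 33 = Dec 4 34 36"
  "prog ! 34 = Inc 2 35" "prog ! 35 = goto 33 Go_Right None" "prog ! 36 = if_one 37 42 Stay"
  "prog ! 37 = find_sep 37 38 Go_Left" "prog ! 38 = Dec 2 39 41" "prog ! 39 = Inc 4 40"
  "prog ! 40 = goto 38 Go_Left None" "prog ! 41 = if_one 44 42 Stay" "prog ! 42 = Dec 2 43 47"
  "prog ! 43 = Inc 4 42" "prog ! 44 = Dec 5 42 45" "prog ! 45 = Inc 5 42" "prog ! 46 = Dec 5 48 49"
  "prog ! 47 = Inc 4 31" "prog ! 48 = goto 25 Stay (Some True)"
  "prog ! 49 = goto 25 Stay (Some False)" "prog ! 50 = Stop"
  by (simp_all add: prog_def)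

lemma length_prog: "length prog = 51"
  by (simp add: prog_def)

lemma valid_prog: "i \<in> set prog \<Longrightarrow> valid_instr (length prog) 6 i"
  unfolding length_prog by (auto simp: prog_def io_defs split: in_symbol.split)

lemma list_update_Cons_numeral: "(a # as)[numeral v := b] = a # as[pred_numeral v := b]"
  by (simp add: numeral_eq_Suc)

definition horner :: "bool list \<Rightarrow> nat \<Rightarrow> nat" where
  "horner bs v = foldl (\<lambda>v b. 2 * v + of_bool b) v bs"

lemma horner_binary: "horner (binary k) 0 = k"
proof (induction k rule: binary.induct)
  case (1 k)
  then show ?case
    by (subst binary.simps) (auto simp: horner_def)
qed

text \<open>Horner's rule never decreases its value. All intermediate values are thus bounded by the
  final one, and reading \<open>m\<close> causes no overflow.\<close>

lemma horner_ge: "v \<le> horner bs v"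
proof (induction bs arbitrary: v)
  case (Cons b bs)
  have "v \<le> 2 * v + of_bool b" by simp
  also have "\<dots> \<le> horner bs (2 * v + of_bool b)" by (rule Cons.IH)
  finally show ?case by (simp add: horner_def)
qed (simp add: horner_def)

lemma ip_snoc: "length as = length bs \<Longrightarrow> ip (as @ [a]) (bs @ [b]) = ((a \<and> b) \<noteq> ip as bs)"
  by (induction as bs rule: list_induct2) auto

lemma ip_take_Suc:
  assumes "t < length as" "t < length bs"
  shows "ip (take (Suc t) as) (take (Suc t) bs) = ((as ! t \<and> bs ! t) \<noteq> ip (take t as) (take t bs))"
  using assms by (simp add: take_Suc_conv_app_nth ip_snoc)

section \<open>Correctness of the counter program\<close>

locale extractor_input =
  fixes x :: "bool list" and n m B :: nat
  assumes x: "length x = n" and m: "1 \<le> m" "3 * m \<le> n" and B: "n < 2 ^ B"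
begin

definition w :: "in_symbol list" where
  "w = encode_input x m"

abbreviation exec :: "cconfig \<Rightarrow> cconfig \<Rightarrow> bool" where
  "exec \<equiv> cexec prog w B"

lemma length_w: "length w = n + 1 + length (binary m)"
  by (simp add: w_def encode_input_def x)

lemma scanned_w:
  "scanned w 0 = Left_End" "p < n \<Longrightarrow> scanned w (Suc p) = Bit (x ! p)"
  "scanned w (Suc n) = Separator"
  "i < length (binary m) \<Longrightarrow> scanned w (n + 2 + i) = Bit (binary m ! i)"
  "scanned w (n + 2 + length (binary m)) = Right_End"
  by (simp_all add: scanned_def w_def encode_input_def x nth_append)

lemma no_end_marker: "w \<noteq> []" "s \<in> set w \<Longrightarrow> s \<noteq> Left_End"
  by (auto simp: w_def encode_input_def)

lemma before_separator: "q < Suc n \<Longrightarrow> scanned w q \<noteq> Separator"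
  using scanned_w(1,2) by (cases q) auto

lemma exec_rewind:
  "p \<le> length w + 1 \<Longrightarrow> prog ! pc = rewind pc r \<Longrightarrow> exec (pc, p, vs, out) (r, 1, vs, out)"
  by (rule rewind_loop) (use no_end_marker in auto)

lemma exec_find_sep:
  "p \<le> Suc n \<Longrightarrow> prog ! pc = find_sep pc r d \<Longrightarrow>
    exec (pc, p, vs, out) (r, min (move d (Suc n)) (length w + 1), vs, out)"
  by (rule find_sep_loop) (use before_separator scanned_w(3) length_w in auto)

lemmas prog_simps = prog_nth prog_nth(2)[simplified] io_defs list_update_Cons_numeral

text \<open>One step of Horner's rule: counter 0 is doubled into the scratch counter and moved back
  before the new bit is added.\<close>

lemma exec_read_bit:
  assumes "scanned w p = Bit b" "p \<le> length w" "2 * v + of_bool b < 2 ^ B"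
  shows "exec (1, p, [v, 0, 0, 0, 0, 0], out) (1, Suc p, [2 * v + of_bool b, 0, 0, 0, 0, 0], out)"
proof -
  have "exec (1, p, [v, 0, 0, 0, 0, 0], out) (2, p, [v, 0, 0, 0, 0, 0], out)"
    by (rule cexec_step[OF _ cexec_refl]) (use assms in \<open>simp add: prog_simps\<close>)
  also have "exec \<dots> (5, p, [0, 0, 2 * v, 0, 0, 0], out)"
    using double_loop[of prog 2 0 3 5 2 4 "[v, 0, 0, 0, 0, 0]" B w p out] assms
    by (simp add: prog_nth list_update_Cons_numeral)
  also have "exec \<dots> (7, p, [2 * v, 0, 0, 0, 0, 0], out)"
    using transfer_loop[of prog 5 2 6 7 0 "[0, 0, 2 * v, 0, 0, 0]" B w p out] assms
    by (simp add: prog_nth list_update_Cons_numeral)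
  also have "exec \<dots> (1, Suc p, [2 * v + of_bool b, 0, 0, 0, 0, 0], out)"
  proof (cases b)
    case True
    with assms show ?thesis
      by - (rule cexec_step, simp add: prog_simps, rule cexec_step, simp add: prog_simps,
          simp add: cexec_refl)
  next
    case False
    with assms show ?thesis
      by - (rule cexec_step, simp add: prog_simps, simp add: cexec_refl)
  qed
  finally show ?thesis .
qed

lemma exec_read: "exec (0, 0, [0, 0, 0, 0, 0, 0], []) (15, 1, [m, m, 0, 0, 0, 0], [])"
proof -
  let ?bs = "binary m"
  have "exec (1, n + 2, [0, 0, 0, 0, 0, 0], [])
      (1, n + 2 + i, [horner (take i ?bs) 0, 0, 0, 0, 0, 0], [])" if "i \<le> length ?bs" for i
    using that
  proof (induction i)
    case 0
    then show ?case by (simp add: horner_def cexec_refl)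
  next
    case (Suc i)
    have eq: "horner (take (Suc i) ?bs) 0 = 2 * horner (take i ?bs) 0 + of_bool (?bs ! i)"
      using Suc by (simp add: horner_def take_Suc_conv_app_nth)
    have "horner (take (Suc i) ?bs) 0 \<le> horner (drop (Suc i) ?bs) (horner (take (Suc i) ?bs) 0)"
      by (rule horner_ge)
    also have "\<dots> = horner (take (Suc i) ?bs @ drop (Suc i) ?bs) 0"
      by (simp only: horner_def foldl_append)
    finally have "horner (take (Suc i) ?bs) 0 \<le> m" by (simp add: horner_binary)
    then have "exec (1, n + 2 + i, [horner (take i ?bs) 0, 0, 0, 0, 0, 0], [])
        (1, Suc (n + 2 + i), [horner (take (Suc i) ?bs) 0, 0, 0, 0, 0, 0], [])"
      unfolding eq using Suc m B length_w by (intro exec_read_bit scanned_w) auto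
    with Suc show ?case using cexec_trans by fastforce
  qed
  from this[of "length ?bs"]
  have read: "exec (1, n + 2, [0, 0, 0, 0, 0, 0], []) (1, n + 2 + length ?bs, [m, 0, 0, 0, 0, 0], [])"
    by (simp add: horner_binary)
  have "exec (0, 0, [0, 0, 0, 0, 0, 0], []) (1, n + 2, [0, 0, 0, 0, 0, 0], [])"
    using exec_find_sep[of 0 0 1 Go_Right] by (simp add: prog_nth length_w)
  also note read
  also have "exec (1, n + 2 + length ?bs, [m, 0, 0, 0, 0, 0], [])
      (9, n + 2 + length ?bs, [m, 0, 0, 0, 0, 0], [])"
    by (rule cexec_step[OF _ cexec_refl]) (use scanned_w(5) in \<open>simp add: prog_simps length_w\<close>)
  also have "exec \<dots> (12, n + 2 + length ?bs, [0, m, m, 0, 0, 0], [])"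
    using copy_loop[of prog 9 0 10 12 1 11 2 "[m, 0, 0, 0, 0, 0]"] m B
    by (simp add: prog_nth list_update_Cons_numeral)
  also have "exec \<dots> (14, n + 2 + length ?bs, [m, m, 0, 0, 0, 0], [])"
    using transfer_loop[of prog 12 2 13 14 0 "[0, m, m, 0, 0, 0]"] m B
    by (simp add: prog_nth list_update_Cons_numeral)
  also have "exec \<dots> (15, 1, [m, m, 0, 0, 0, 0], [])"
    by (rule exec_rewind) (simp_all add: prog_nth length_w)
  finally show ?thesis .
qed

text \<open>Each round passes three bits of \<open>x\<close>. Counters 1 and 2 always sum to
  \<open>m\<close>; when counter 1 runs out, \<open>3 * m\<close> bits have been passed, so counter
  3 is incremented and the scratch counter refills counter 1.\<close>

lemma exec_divide:
  "3 * i \<le> n \<Longrightarrow> exec (15, 1, [m, m, 0, 0, 0, 0], [])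
    (15, 3 * i + 1, [m, m - i mod m, i mod m, i div m, 0, 0], [])"
proof (induction i)
  case 0
  then show ?case by (simp add: cexec_refl)
next
  case (Suc i)
  let ?p = "3 * i + 1"
  have mod: "i mod m < m" using m by simp
  have "Suc i \<le> n" using Suc.prems by simp
  then have "Suc (i div m) \<le> n" using div_le_dividend[of i m] by linarith
  with B have "Suc (i div m) < 2 ^ B" by linarith
  moreover have "m < 2 ^ B" using m B by linarith
  ultimately have less: "Suc (i mod m) < 2 ^ B" "Suc (i div m) < 2 ^ B" "m < 2 ^ B"
    using mod by linarith+
  have "exec (15, ?p, [m, m - i mod m, i mod m, i div m, 0, 0], [])
      (15, Suc (Suc (Suc ?p)), [m, m - i mod m - 1, Suc (i mod m), i div m, 0, 0], [])"
    by (rule cexec_step, (use mod in \<open>simp add: prog_simps\<close>),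
        rule cexec_step, (use Suc in \<open>simp add: prog_simps scanned_w length_w\<close>),
        rule cexec_step, (use Suc in \<open>simp add: prog_simps scanned_w length_w\<close>),
        rule cexec_step, (use Suc in \<open>simp add: prog_simps scanned_w length_w\<close>),
        rule cexec_step, (use less in \<open>simp add: prog_simps\<close>),
        simp add: cexec_refl list_update_Cons_numeral)
  also have "Suc (Suc (Suc ?p)) = 3 * Suc i + 1" by simp
  also have "exec (15, 3 * Suc i + 1, [m, m - i mod m - 1, Suc (i mod m), i div m, 0, 0], [])
      (15, 3 * Suc i + 1, [m, m - Suc i mod m, Suc i mod m, Suc i div m, 0, 0], [])"
  proof (cases "Suc (i mod m) = m")
    case False
    then show ?thesis using mod by (simp add: mod_Suc div_Suc cexec_refl)
  next
    case True
    let ?q = "3 * Suc i + 1"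
    have "exec (15, ?q, [m, m - i mod m - 1, Suc (i mod m), i div m, 0, 0], [])
       (21, ?q, [m, 0, m, Suc (i div m), 0, 0], [])"
      by (rule cexec_step, (use True in \<open>simp add: prog_simps\<close>),
          rule cexec_step, (use less in \<open>simp add: prog_simps\<close>),
          use True in \<open>simp add: cexec_refl list_update_Cons_numeral\<close>)
    also have "exec \<dots> (15, ?q, [m, m, 0, Suc (i div m), 0, 0], [])"
      using transfer_loop[of prog 21 2 22 15 1 "[m, 0, m, Suc (i div m), 0, 0]"] less
      by (simp add: prog_nth list_update_Cons_numeral)
    finally show ?thesis using True by (simp add: mod_Suc div_Suc)
  qed
  finally show ?case using Suc cexec_trans by simp
qed

definition k :: nat where "k = n div (3 * m)"

lemma mk: "3 * (m * k) \<le> n"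
  using div_times_less_eq_dividend[of n "3 * m"] by (simp add: k_def algebra_simps)

lemma exec_preprocess:
  "\<exists>p\<le>length w. exec (0, 0, [0, 0, 0, 0, 0, 0], []) (25, p, [m, 0, 0, k, 0, 0], [])"
proof -
  define i where "i = n div 3"
  \<comment> \<open>The last round is aborted at the separator, after counter 1 has already been
    decremented.\<close>
  define M where "M = m - i mod m - 1"
  have i: "3 * i \<le> n" "n < 3 * i + 3" by (auto simp: i_def)
  have "\<exists>p\<le>length w. exec (15, 3 * i + 1, [m, m - i mod m, i mod m, i div m, 0, 0], [])
      (23, p, [m, M, i mod m, i div m, 0, 0], [])"
  proof (intro exI[of _ "Suc n"] conjI)
    have mod: "i mod m < m" using m by simp
    \<comment> \<open>The separator can stop each of the three bit tests of a round, depending on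
      the remainder of \<open>n\<close> modulo 3.\<close>
    from i consider "n = 3 * i" | "n = Suc (3 * i)" | "n = Suc (Suc (3 * i))" by linarith
    then show "exec (15, 3 * i + 1, [m, m - i mod m, i mod m, i div m, 0, 0], [])
        (23, Suc n, [m, M, i mod m, i div m, 0, 0], [])"
    proof cases
      case 1
      then show ?thesis
        by - (rule cexec_step, (use mod in \<open>simp add: prog_simps\<close>),
          rule cexec_step, (use scanned_w(3) in \<open>simp add: prog_simps length_w\<close>),
          simp add: cexec_refl M_def)
    next
      case 2
      then show ?thesis
        by - (rule cexec_step, (use mod in \<open>simp add: prog_simps\<close>),
          rule cexec_step, (use scanned_w(2)[of "3 * i"] in \<open>simp add: prog_simps length_w\<close>),
          rule cexec_step, (use scanned_w(3) in \<open>simp add: prog_simps length_w\<close>),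
          simp add: cexec_refl M_def)
    next
      case 3
      then show ?thesis
        by - (rule cexec_step, (use mod in \<open>simp add: prog_simps\<close>),
          rule cexec_step, (use scanned_w(2)[of "3 * i"] in \<open>simp add: prog_simps length_w\<close>),
          rule cexec_step, (use scanned_w(2)[of "Suc (3 * i)"] in \<open>simp add: prog_simps length_w\<close>),
          rule cexec_step, (use scanned_w(3) in \<open>simp add: prog_simps length_w\<close>),
          simp add: cexec_refl M_def)
    qed
  qed (simp add: length_w)
  then obtain p where p: "p \<le> length w" "exec (15, 3 * i + 1, [m, m - i mod m, i mod m, i div m, 0, 0], [])
      (23, p, [m, M, i mod m, i div m, 0, 0], [])" by blast
  note exec_read
  also note exec_divide[OF i(1)]
  also note p(2)
  also have "exec (23, p, [m, M, i mod m, i div m, 0, 0], []) (24, p, [m, M, 0, i div m, 0, 0], [])"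
    using clear_loop[of prog 23 2 24 "[m, M, i mod m, i div m, 0, 0]"]
    by (simp add: prog_nth list_update_Cons_numeral)
  also have "exec \<dots> (25, p, [m, 0, 0, i div m, 0, 0], [])"
    using clear_loop[of prog 24 1 25 "[m, M, 0, i div m, 0, 0]"]
    by (simp add: prog_nth)
  also have "i div m = k" by (simp add: i_def k_def div_mult2_eq)
  finally show ?thesis using p(1) by blast
qed

text \<open>The head finds bit \<open>P\<close> of \<open>x\<close> by counting from the left end,
  and bit \<open>P\<close> of \<open>rev x\<close> by counting backwards from the separator. During
  each walk the position moves between counters 4 and 2. The second bit is read only if the first
  one is set.\<close>

lemma exec_pair:
  assumes P: "P < n" and p: "p \<le> length w"
  shows "\<exists>p'\<le>length w. exec (31, p, [K, Suc M, 0, T, P, of_bool a], out)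
    (31, p', [K, M, 0, T, Suc P, of_bool ((x ! P \<and> rev x ! P) \<noteq> a)], out)"
proof -
  have less: "P < 2 ^ B" "Suc P < 2 ^ B" and "1 < (2::nat) ^ B" using P m B by linarith+
  have toggle: "exec (44, q, [K, M, Q, T, P', of_bool a], out) (42, q, [K, M, Q, T, P', of_bool (\<not> a)], out)"
    for q Q P'
  proof (cases a)
    case True
    then show ?thesis
      by - (rule cexec_step, simp add: prog_simps, simp add: cexec_refl)
  next
    case False
    then show ?thesis using \<open>1 < (2::nat) ^ B\<close>
      by - (rule cexec_step, simp add: prog_simps, rule cexec_step, simp add: prog_simps,
        simp add: cexec_refl)
  qed
  \<comment> \<open>The position may have been left in either counter: in the scratch counter after
    one walk, in counter 4 after two.\<close>
  have finish: "exec (42, q, [K, M, Q, T, P', c], out) (31, q, [K, M, 0, T, Suc P, c], out)"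
    if "Q + P' = P" for q Q P' c
  proof -
    have "exec (42, q, [K, M, Q, T, P', c], out) (47, q, [K, M, 0, T, P, c], out)"
      using transfer_loop[of prog 42 2 43 47 4 "[K, M, Q, T, P', c]"] less that
      by (simp add: prog_nth list_update_Cons_numeral)
    also have "exec \<dots> (31, q, [K, M, 0, T, Suc P, c], out)"
      by (rule cexec_step[OF _ cexec_refl]) (use less in \<open>simp add: prog_simps\<close>)
    finally show ?thesis .
  qed
  have "exec (31, p, [K, Suc M, 0, T, P, of_bool a], out) (32, p, [K, M, 0, T, P, of_bool a], out)"
    by (rule cexec_step[OF _ cexec_refl]) (simp add: prog_simps)
  also have "exec \<dots> (33, 1, [K, M, 0, T, P, of_bool a], out)"
    by (rule exec_rewind) (use p in \<open>simp_all add: prog_nth\<close>)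
  also have "exec \<dots> (36, Suc P, [K, M, P, T, 0, of_bool a], out)"
    using walk_right_loop[of prog 33 4 34 36 2 35 "[K, M, 0, T, P, of_bool a]" B 1 w] less P
    by (simp add: prog_nth goto_def list_update_Cons_numeral length_w)
  finally have start: "exec (31, p, [K, Suc M, 0, T, P, of_bool a], out)
    (36, Suc P, [K, M, P, T, 0, of_bool a], out)" .
  show ?thesis
  proof (cases "x ! P")
    case False
    then have "exec (36, Suc P, [K, M, P, T, 0, of_bool a], out) (42, Suc P, [K, M, P, T, 0, of_bool a], out)"
      by (intro cexec_step[OF _ cexec_refl]) (use P in \<open>simp add: prog_simps scanned_w length_w\<close>)
    from cexec_trans[OF start cexec_trans[OF this finish]] show ?thesis
      using False P by (intro exI[of _ "Suc P"]) (simp add: length_w)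
  next
    case True
    define b where "b = rev x ! P"
    \<comment> \<open>Cell \<open>n - P\<close> holds bit \<open>n - P - 1\<close> of
      \<open>x\<close>, because cells of the input tape are counted from 1.\<close>
    have b: "scanned w (n - P) = Bit b"
      using scanned_w(2)[of "n - Suc P"] P by (simp add: b_def rev_nth x Suc_diff_Suc)
    note start
    also have "exec (36, Suc P, [K, M, P, T, 0, of_bool a], out) (37, Suc P, [K, M, P, T, 0, of_bool a], out)"
      by (rule cexec_step[OF _ cexec_refl]) (use P True in \<open>simp add: prog_simps scanned_w length_w\<close>)
    also have "exec \<dots> (38, n, [K, M, P, T, 0, of_bool a], out)"
      using exec_find_sep[of "Suc P" 37 38 Go_Left] P by (simp add: prog_nth length_w)
    also have "exec \<dots> (41, n - P, [K, M, 0, T, P, of_bool a], out)"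
      using walk_left_loop[of prog 38 2 39 41 4 40 "[K, M, P, T, 0, of_bool a]" B n w] less P
      by (simp add: prog_nth goto_def list_update_Cons_numeral length_w)
    also have "exec \<dots> (42, n - P, [K, M, 0, T, P, of_bool (b \<noteq> a)], out)"
    proof (cases b)
      case True
      have "exec (41, n - P, [K, M, 0, T, P, of_bool a], out) (44, n - P, [K, M, 0, T, P, of_bool a], out)"
        by (rule cexec_step[OF _ cexec_refl]) (use True in \<open>simp add: prog_simps b length_w\<close>)
      also note toggle
      finally show ?thesis using True by simp
    next
      case False
      then show ?thesis
        by (intro cexec_step[OF _ cexec_refl]) (simp add: prog_simps b length_w)
    qed
    also have "exec \<dots> (31, n - P, [K, M, 0, T, Suc P, of_bool (b \<noteq> a)], out)"
      by (rule finish) simp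
    finally show ?thesis
      using True by (intro exI[of _ "n - P"]) (simp add: b_def length_w)
  qed
qed

lemma exec_block:
  assumes j: "j < m" and p: "p \<le> length w" and t: "t \<le> k"
  shows "\<exists>p'\<le>length w. exec (31, p, [K, k, 0, T, j * k, 0], out)
    (31, p', [K, k - t, 0, T, j * k + t,
      of_bool (ip (take t (block k j x)) (take t (block k j (rev x))))], out)"
  using t
proof (induction t)
  case 0
  then show ?case using p by (auto intro: cexec_refl)
next
  case (Suc t)
  let ?ip = "\<lambda>t. ip (take t (block k j x)) (take t (block k j (rev x)))"
  obtain p1 where p1: "p1 \<le> length w" "exec (31, p, [K, k, 0, T, j * k, 0], out)
      (31, p1, [K, k - t, 0, T, j * k + t, of_bool (?ip t)], out)"
    using Suc by auto
  have "j * k + k \<le> m * k" using mult_le_mono1[of "Suc j" m k] j by simp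
  then have jk: "j * k + k \<le> n" using mk by linarith
  then have "?ip (Suc t) = ((x ! (j * k + t) \<and> rev x ! (j * k + t)) \<noteq> ?ip t)"
    using Suc by (simp add: ip_take_Suc block_def x)
  then obtain p2 where p2: "p2 \<le> length w"
    "exec (31, p1, [K, Suc (k - Suc t), 0, T, j * k + t, of_bool (?ip t)], out)
      (31, p2, [K, k - Suc t, 0, T, Suc (j * k + t), of_bool (?ip (Suc t))], out)"
    using exec_pair[of "j * k + t" p1 K "k - Suc t" T "?ip t" out] jk Suc p1(1) by auto
  have "Suc (k - Suc t) = k - t" using Suc by simp
  with cexec_trans[OF p1(2)] p2(2)
  have "exec (31, p, [K, k, 0, T, j * k, 0], out)
      (31, p2, [K, k - Suc t, 0, T, j * k + Suc t, of_bool (?ip (Suc t))], out)"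
    by (simp only: add_Suc_right)
  with p2(1) show ?case by blast
qed

text \<open>Counter 4 is not reset between blocks: after block \<open>j\<close> it contains
  \<open>j * k + k\<close>, where the next block begins. The branch that selects the output bit also
  clears the parity.\<close>

lemma exec_outputs:
  assumes p: "p \<le> length w"
  shows "j \<le> m \<Longrightarrow> \<exists>p'\<le>length w. exec (25, p, [m, 0, 0, k, 0, 0], [])
    (25, p', [m - j, 0, 0, k, j * k, 0], map (block_ip k x) [0..<j])"
proof (induction j)
  case 0
  then show ?case using p by (auto intro: cexec_refl)
next
  case (Suc j)
  let ?K = "m - Suc j" and ?out = "map (block_ip k x) [0..<j]"
  \<comment> \<open>The working copies of \<open>k\<close> stay below the overflow bound, because
    \<open>m\<close> blocks of length \<open>k\<close> fit into \<open>x\<close>.\<close>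
  have "k \<le> m * k" using m by simp
  then have k: "k < 2 ^ B" using mk B by linarith
  obtain p1 where p1: "p1 \<le> length w" "exec (25, p, [m, 0, 0, k, 0, 0], [])
      (25, p1, [m - j, 0, 0, k, j * k, 0], ?out)"
    using Suc by auto
  obtain p2 where p2: "p2 \<le> length w" "exec (31, p1, [?K, k, 0, k, j * k, 0], ?out)
      (31, p2, [?K, 0, 0, k, j * k + k, of_bool (block_ip k x j)], ?out)"
    using exec_block[of j p1 k ?K k ?out] Suc p1(1) by (auto simp: block_ip_def block_def)
  note p1(2)
  also have "exec (25, p1, [m - j, 0, 0, k, j * k, 0], ?out) (26, p1, [?K, 0, 0, k, j * k, 0], ?out)"
    by (rule cexec_step[OF _ cexec_refl]) (use Suc in \<open>simp add: prog_simps\<close>)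
  also have "exec \<dots> (29, p1, [?K, k, k, 0, j * k, 0], ?out)"
    using copy_loop[of prog 26 3 27 29 1 28 2 "[?K, 0, 0, k, j * k, 0]"] k
    by (simp add: prog_nth list_update_Cons_numeral)
  also have "exec \<dots> (31, p1, [?K, k, 0, k, j * k, 0], ?out)"
    using transfer_loop[of prog 29 2 30 31 3 "[?K, k, k, 0, j * k, 0]"] k
    by (simp add: prog_nth list_update_Cons_numeral)
  also note p2(2)
  also have "exec (31, p2, [?K, 0, 0, k, j * k + k, of_bool (block_ip k x j)], ?out)
    (46, p2, [?K, 0, 0, k, j * k + k, of_bool (block_ip k x j)], ?out)"
    by (rule cexec_step[OF _ cexec_refl]) (simp add: prog_simps)
  also have "exec \<dots> (25, p2, [?K, 0, 0, k, j * k + k, 0], ?out @ [block_ip k x j])"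
  proof (cases "block_ip k x j")
    case True
    with p2(1) show ?thesis
      by - (rule cexec_step, simp add: prog_simps, rule cexec_step, simp add: prog_simps,
        simp add: cexec_refl)
  next
    case False
    with p2(1) show ?thesis
      by - (rule cexec_step, simp add: prog_simps, rule cexec_step, simp add: prog_simps,
        simp add: cexec_refl)
  qed
  finally show ?case using p2(1) by (auto simp: add.commute)
qed

lemma exec_prog: "\<exists>p vs. exec (0, 0, replicate 6 0, []) (50, p, vs, extractor n m x)"
proof -
  have zeros: "replicate 6 0 = [0, 0, 0, 0, 0, 0]"
    by (simp add: eval_nat_numeral)
  obtain p where p: "p \<le> length w"
    "exec (0, 0, [0, 0, 0, 0, 0, 0], []) (25, p, [m, 0, 0, k, 0, 0], [])"
    using exec_preprocess by blast
  obtain p' where "exec (25, p, [m, 0, 0, k, 0, 0], []) (25, p', [0, 0, 0, k, m * k, 0], extractor n m x)"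
    using exec_outputs[OF p(1), of m] by (auto simp: extractor_def k_def)
  also have "exec \<dots> (50, p', [0, 0, 0, k, m * k, 0], extractor n m x)"
    by (rule cexec_step[OF _ cexec_refl]) (simp add: prog_simps)
  finally have "exec (25, p, [m, 0, 0, k, 0, 0], []) (50, p', [0, 0, 0, k, m * k, 0], extractor n m x)" .
  from cexec_trans[OF p(2) this]
  have "exec (0, 0, replicate 6 0, []) (50, p', [0, 0, 0, k, m * k, 0], extractor n m x)"
    unfolding zeros .
  then show ?thesis by blast
qed

end

section \<open>Logarithmic space and conclusion\<close>

text \<open>All counters stay at or below \<open>n\<close>, so \<open>B\<close> digits suffice with
  \<open>B\<close> at most \<open>log 2 n + 1\<close>. The tapes use \<open>B + 2\<close> cells, and
  \<open>log 2 n + 3\<close> is at most \<open>4 * log 2 n\<close> because \<open>n\<close> is at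
  least 3.\<close>

lemma extractor_in_space:
  assumes "1 \<le> m" "3 * m \<le> n" "x \<in> bits n"
  shows "computes_in_space (compile prog 6) (encode_input x m) (extractor n m x) (4 * log 2 (real n))"
proof -
  define B where "B = Suc (nat \<lfloor>log 2 (real n)\<rfloor>)"
  have log: "1 \<le> log 2 (real n)" using assms by (simp add: le_log_iff)
  have "log 2 (real n) < real B" unfolding B_def using log by linarith
  then have "real n < 2 powr real B" using assms by (simp add: log_less_iff)
  then have n: "n < 2 ^ B" by (simp add: powr_realpow flip: of_nat_less_iff)
  have space: "real (B + 2) \<le> 4 * log 2 (real n)" unfolding B_def using log by linarith
  interpret extractor_input x n m B
    by unfold_locales (use assms n in \<open>auto simp: bits_def\<close>)
  obtain p vs where "exec (0, 0, replicate 6 0, []) (50, p, vs, extractor n m x)"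
    using exec_prog by blast
  then show ?thesis
    unfolding w_def using length_prog
    by (intro compile_computes[OF _ valid_prog _ _ space]) (auto simp: prog_nth)
qed

theorem theorem4p9:
  "\<exists>\<alpha>::real. \<alpha> > 0 \<and> (\<exists>R :: nat \<Rightarrow> nat \<Rightarrow> bool list \<Rightarrow> bool list.
     (\<forall>n m :: nat. 1 \<le> m \<and> real m \<le> real n / 3 \<longrightarrow>
        (\<forall>x\<in>bits n. R n m x \<in> bits m) \<and>
        (\<forall>(P :: rbp) (f :: bool list \<Rightarrow> bool) (\<delta> :: real).
           is_rbp n m P \<and> is_SR P \<and> computes_with_failure n m P f \<delta> \<and>
           real (queries P) * real_of_int \<lceil>log 2 (real (rbp_size P))\<rceil> * real m
             \<le> \<alpha> * (real n)\<^sup>2 \<longrightarrow>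
           cube_density n {x\<in>bits n. rbp_output P x (R n m x) \<noteq> f x}
             \<le> 3 * \<delta> + real m * 2 powr (- \<alpha> * real n / real m))) \<and>
     (\<exists>(M :: tm) (C :: real). is_tm M \<and>
        (\<forall>n m :: nat. 1 \<le> m \<and> real m \<le> real n / 3 \<longrightarrow>
           (\<forall>x\<in>bits n.
              computes_in_space M (encode_input x m) (R n m x) (C * log 2 (real n))))))"
proof (rule exI[of _ "1 / 100"], intro conjI, simp, rule exI[of _ extractor], intro conjI allI impI)
  fix n m
  assume nm: "1 \<le> m \<and> real m \<le> real n / 3"
  show "\<forall>x\<in>bits n. extractor n m x \<in> bits m"
    by (simp add: extractor_def bits_def)
  fix P f \<delta>
  assume "is_rbp n m P \<and> is_SR P \<and> computes_with_failure n m P f \<delta> \<and>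
    real (queries P) * real_of_int \<lceil>log 2 (real (rbp_size P))\<rceil> * real m \<le> 1 / 100 * (real n)\<^sup>2"
  with nm show "cube_density n {x\<in>bits n. rbp_output P x (extractor n m x) \<noteq> f x}
    \<le> 3 * \<delta> + real m * 2 powr (- (1 / 100) * real n / real m)"
    by (intro extractor_error) auto
next
  \<comment> \<open>A single machine with six work tapes and the single constant 4 serve all
    \<open>n\<close> and \<open>m\<close>.\<close>
  have "is_tm (compile prog 6)"
    by (rule is_tm_compile[OF _ valid_prog]) (use length_prog in auto)
  moreover have "computes_in_space (compile prog 6) (encode_input x m) (extractor n m x) (4 * log 2 (real n))"
    if "1 \<le> m \<and> real m \<le> real n / 3" "x \<in> bits n" for n m x
    using that by (intro extractor_in_space) auto
  ultimately show "\<exists>(M :: tm) (C :: real). is_tm M \<and>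
      (\<forall>n m :: nat. 1 \<le> m \<and> real m \<le> real n / 3 \<longrightarrow>
        (\<forall>x\<in>bits n. computes_in_space M (encode_input x m) (extractor n m x) (C * log 2 (real n))))"
    by blast
qed

end
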